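(* Let $\mathbb{F}$ be an algebraically closed field and let $q\in\mathbb{F}$ be nonzero with $q^4\neq 1$. Let $\Delta$ be the universal Askey-Wilson algebra and let $L$ be the Lie subalgebra of $\Delta$ generated by $A,B,C$. Then the standard Lie monomials of $L$ of length at most $4$ (the images in $L$ of the $32$ Hall basis elements of length at most $4$) form a basis for $L_4$.
   Context: $\mathbb{F}\langle A,B,C\rangle$ is the free unital associative $\mathbb{F}$-algebra; every associative algebra is a Lie algebra with $[X,Y]=XY-YX$. Put $\alpha=(q+q^{-1})A+\frac{qBC-q^{-1}CB}{q-q^{-1}}$, $\beta=(q+q^{-1})B+\frac{qCA-q^{-1}AC}{q-q^{-1}}$, $\gamma=(q+q^{-1})C+\frac{qAB-q^{-1}BA}{q-q^{-1}}$. $\Delta$ is the quotient of $\mathbb{F}\langle A,B,C\rangle$ by the two-sided ideal generated by the nine commutators $[X,\delta]$, $X\in\{A,B,C\}$, $\delta\in\{\alpha,\beta,\gamma\}$. $\mathcal{L}$ is the free Lie algebra on $\{A,B,C\}$ (the Lie subalgebra of $\mathbb{F}\langle A,B,C\rangle$ generated by $A,B,C$). Its Hall basis is built with $A<B<C$: Lie monomials are ordered first by length, and $[X_1,Y_1],[X_2,Y_2]$ of the same length satisfy $[X_1,Y_1]<[X_2,Y_2]$ iff $Y_1<Y_2$, or $Y_1=Y_2$ and $X_1<X_2$. The letters are Hall elements, and for Hall elements $U,V$, $[U,V]$ is a Hall element if $U>V$ and, in case $U=[X,Y]$, also $Y\le V$. For a word $X_1X_2\cdots X_t$ let $[X_1X_2\cdots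 X_t]=[[\cdots[[X_1,X_2],X_3],\cdots],X_t]$ (so e.g. $[BA^2C]=[[[B,A],A],C]$). The Hall elements of length at most $4$ are: $A,B,C$; $[BA],[CA],[CB]$; $[BA^2],[CA^2],[BAB],[CAB],[CB^2],[BAC],[CAC],[CBC]$; $[BA^3],[CA^3],[BA^2B],[CA^2B],[BAB^2],[CAB^2],[CB^3],[BA^2C],[CA^2C],[BABC],[CABC],[CB^2C],[BAC^2],[CAC^2],[CBC^2]$, $[[CA],[BA]]$, $[[CB],[BA]]$, $[[CB],[CA]]$. The standard Lie monomials of $L$ are the images of the Hall elements under the canonical map $\mathcal{L}\to L$, and $L_n$ is the span in $L$ of the standard Lie monomials of length at most $n$. *)

theory Defs
  imports
    "HOL-Library.Poly_Mapping"
    "HOL-Computational_Algebra.Polynomial"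
    "HOL-Algebra.QuotRing"
    "HOL-Algebra.Embedded_Algebras"
    "HOL-Algebra.Algebraic_Closure_Type"
begin

section \<open>The free associative algebra on three letters\<close>

datatype letter = LA | LB | LC

text \<open>Words form the free monoid on the letters.  It is written additively because
  the convolution product of \<^type>\<open>poly_mapping\<close> expects \<^class>\<open>monoid_add\<close>
  (no commutativity is involved).\<close>

datatype word = Word "letter list"

instantiation word :: monoid_add
begin

definition zero_word :: word where "0 = Word []"

fun plus_word :: "word \<Rightarrow> word \<Rightarrow> word" where
  "Word u + Word v = Word (u @ v)"

instance
proof
  fix a b c :: word
  show "a + b + c = a + (b + c)" by (cases a; cases b; cases c) simp
  show "0 + a = a" by (cases a) (simp add: zero_word_def)
  show "a + 0 = a" by (cases a) (simp add: zero_word_def)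
qed

end

type_synonym 'k free_alg = "word \<Rightarrow>\<^sub>0 'k"

definition gen :: "letter \<Rightarrow> 'k::field free_alg" where
  "gen x = Poly_Mapping.single (Word [x]) 1"

definition scal :: "'k::field \<Rightarrow> 'k free_alg" where
  "scal c = Poly_Mapping.single 0 c"

definition comm :: "'a::ring_1 \<Rightarrow> 'a \<Rightarrow> 'a" where
  "comm x y = x * y - y * x"


section \<open>The universal Askey-Wilson algebra\<close>

text \<open>\<open>aw_elt q x y z\<close> is \<open>(q + q\<^sup>-\<^sup>1) x + (q y z - q\<^sup>-\<^sup>1 z y) / (q - q\<^sup>-\<^sup>1)\<close>.\<close>

definition aw_elt :: "'k::field \<Rightarrow> 'k free_alg \<Rightarrow> 'k free_alg \<Rightarrow> 'k free_alg \<Rightarrow> 'k free_alg" where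
  "aw_elt q x y z = scal (q + inverse q) * x
     + scal (inverse (q - inverse q)) * (scal q * (y * z) - scal (inverse q) * (z * y))"

definition aw_alpha :: "'k::field \<Rightarrow> 'k free_alg" where
  "aw_alpha q = aw_elt q (gen LA) (gen LB) (gen LC)"

definition aw_beta :: "'k::field \<Rightarrow> 'k free_alg" where
  "aw_beta q = aw_elt q (gen LB) (gen LC) (gen LA)"

definition aw_gamma :: "'k::field \<Rightarrow> 'k free_alg" where
  "aw_gamma q = aw_elt q (gen LC) (gen LA) (gen LB)"

definition aw_relators :: "'k::field \<Rightarrow> 'k free_alg set" where
  "aw_relators q = {comm (gen x) d | x d. d \<in> {aw_alpha q, aw_beta q, aw_gamma q}}"

text \<open>\<^const>\<open>ideal\<close> is two-sided in HOL-Algebra, so \<^const>\<open>genideal\<close> is the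
  two-sided ideal generated by a set.\<close>

definition aw_ideal :: "'k::field \<Rightarrow> 'k free_alg set" where
  "aw_ideal q = genideal ring_of_type_algebra (aw_relators q)"

definition aw_algebra :: "'k::field \<Rightarrow> 'k free_alg set ring" where
  "aw_algebra q = ring_of_type_algebra Quot (aw_ideal q)"

definition aw_proj :: "'k::field \<Rightarrow> 'k free_alg \<Rightarrow> 'k free_alg set" where
  "aw_proj q x = a_r_coset ring_of_type_algebra (aw_ideal q) x"

text \<open>The image of the ground field in the quotient: the \<open>K\<close>-linear notions of
  \<^theory>\<open>HOL-Algebra.Embedded_Algebras\<close> for this \<open>K\<close> are the linear notions over
  the ground field.\<close>

definition aw_scalars :: "'k::field \<Rightarrow> 'k free_alg set set" where
  "aw_scalars q = (\<lambda>c. aw_proj q (scal c)) ` UNIV"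

lemma ring_free_alg: "ring (ring_of_type_algebra :: 'k::field free_alg ring)"
proof -
  have "\<exists>y. x + y = 0" for x :: "'k free_alg"
    using add.right_inverse by blast
  then show ?thesis
    unfolding ring_of_type_algebra_def using add.right_inverse
    by unfold_locales (auto simp: algebra_simps Units_def)
qed

lemma ring_aw_algebra: "ring (aw_algebra q)"
  unfolding aw_algebra_def aw_ideal_def
  by (intro ideal.quotient_is_ring ring.genideal_ideal ring_free_alg)
     (simp add: ring_of_type_algebra_def)


section \<open>Lie subalgebras and linear spans\<close>

text \<open>\<open>subalgebra K V R\<close> from the library only says that \<open>V\<close> is a \<open>K\<close>-linear
  subspace of \<open>R\<close>; no closure under multiplication is required.\<close>

definition lie_subalgebra :: "'a set \<Rightarrow> 'a set \<Rightarrow> ('a, 'b) ring_scheme \<Rightarrow> bool" where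
  "lie_subalgebra K V R \<longleftrightarrow> subalgebra K V R \<and>
     (\<forall>x\<in>V. \<forall>y\<in>V. x \<otimes>\<^bsub>R\<^esub> y \<ominus>\<^bsub>R\<^esub> y \<otimes>\<^bsub>R\<^esub> x \<in> V)"

definition lie_generated :: "'a set \<Rightarrow> ('a, 'b) ring_scheme \<Rightarrow> 'a set \<Rightarrow> 'a set" where
  "lie_generated K R S = \<Inter>{V. lie_subalgebra K V R \<and> S \<subseteq> V}"

definition linear_span_in :: "'a set \<Rightarrow> ('a, 'b) ring_scheme \<Rightarrow> 'a set \<Rightarrow> 'a set \<Rightarrow> 'a set" where
  "linear_span_in K R L S = \<Inter>{V. subalgebra K V R \<and> V \<subseteq> L \<and> S \<subseteq> V}"

text \<open>The family \<open>(f i)\<^sub>i\<close>, \<open>i \<in> I\<close>, with \<open>I\<close> finite, is a basis of \<open>V\<close>.  The library notions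
  are about lists of vectors, hence the enumerations of \<open>I\<close>; repeated vectors make a list
  dependent, so \<open>f\<close> is required to be injective on \<open>I\<close>.\<close>

definition family_basis ::
    "'a set \<Rightarrow> ('a, 'b) ring_scheme \<Rightarrow> ('i \<Rightarrow> 'a) \<Rightarrow> 'i set \<Rightarrow> 'a set \<Rightarrow> bool" where
  "family_basis K R f I V \<longleftrightarrow> finite I \<and>
     (\<forall>us. distinct us \<and> set us = I \<longrightarrow>
        ring.independent R K (map f us) \<and> ring.Span R K (map f us) = V)"


section \<open>Hall elements\<close>

datatype lie_mon = Ltr letter | Br lie_mon lie_mon

fun lie_length :: "lie_mon \<Rightarrow> nat" where
  "lie_length (Ltr x) = 1"
| "lie_length (Br u v) = lie_length u + lie_length v"

fun letter_less :: "letter \<Rightarrow> letter \<Rightarrow> bool" where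
  "letter_less LA y \<longleftrightarrow> y \<noteq> LA"
| "letter_less LB y \<longleftrightarrow> y = LC"
| "letter_less LC y \<longleftrightarrow> False"

text \<open>Length first; a letter is shorter than every bracket.\<close>

fun lie_less :: "lie_mon \<Rightarrow> lie_mon \<Rightarrow> bool" where
  "lie_less (Ltr x) (Ltr y) \<longleftrightarrow> letter_less x y"
| "lie_less (Ltr x) (Br u v) \<longleftrightarrow> True"
| "lie_less (Br u v) (Ltr x) \<longleftrightarrow> False"
| "lie_less (Br x1 y1) (Br x2 y2) \<longleftrightarrow>
     lie_length (Br x1 y1) < lie_length (Br x2 y2) \<or>
     lie_length (Br x1 y1) = lie_length (Br x2 y2) \<and>
       (lie_less y1 y2 \<or> y1 = y2 \<and> lie_less x1 x2)"

fun hall :: "lie_mon \<Rightarrow> bool" where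
  "hall (Ltr x) \<longleftrightarrow> True"
| "hall (Br u v) \<longleftrightarrow> hall u \<and> hall v \<and> lie_less v u \<and>
     (case u of Ltr _ \<Rightarrow> True | Br x y \<Rightarrow> lie_less y v \<or> y = v)"

definition hall_upto :: "nat \<Rightarrow> lie_mon set" where
  "hall_upto n = {h. hall h \<and> lie_length h \<le> n}"

text \<open>Evaluation in the free associative algebra; its values on \<^const>\<open>hall\<close> monomials
  are the Hall basis of the free Lie algebra.\<close>

fun lie_eval :: "lie_mon \<Rightarrow> 'k::field free_alg" where
  "lie_eval (Ltr x) = gen x"
| "lie_eval (Br u v) = comm (lie_eval u) (lie_eval v)"

text \<open>The left-normed monomial \<open>[[\<dots>[[X\<^sub>1, X\<^sub>2], X\<^sub>3], \<dots>], X\<^sub>t]\<close>; the arguments are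
  \<open>X\<^sub>1\<close> and the list \<open>X\<^sub>2, \<dots>, X\<^sub>t\<close>.\<close>

definition lnorm :: "letter \<Rightarrow> letter list \<Rightarrow> lie_mon" where
  "lnorm x xs = foldl (\<lambda>u y. Br u (Ltr y)) (Ltr x) xs"

definition hall_list4 :: "lie_mon list" where
  "hall_list4 =
    [lnorm LA [], lnorm LB [], lnorm LC [],
     lnorm LB [LA], lnorm LC [LA], lnorm LC [LB],
     lnorm LB [LA, LA], lnorm LC [LA, LA], lnorm LB [LA, LB], lnorm LC [LA, LB],
     lnorm LC [LB, LB], lnorm LB [LA, LC], lnorm LC [LA, LC], lnorm LC [LB, LC],
     lnorm LB [LA, LA, LA], lnorm LC [LA, LA, LA], lnorm LB [LA, LA, LB],
     lnorm LC [LA, LA, LB], lnorm LB [LA, LB, LB], lnorm LC [LA, LB, LB],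
     lnorm LC [LB, LB, LB], lnorm LB [LA, LA, LC], lnorm LC [LA, LA, LC],
     lnorm LB [LA, LB, LC], lnorm LC [LA, LB, LC], lnorm LC [LB, LB, LC],
     lnorm LB [LA, LC, LC], lnorm LC [LA, LC, LC], lnorm LC [LB, LC, LC],
     Br (lnorm LC [LA]) (lnorm LB [LA]),
     Br (lnorm LC [LB]) (lnorm LB [LA]),
     Br (lnorm LC [LB]) (lnorm LC [LA])]"

lemma distinct_hall_list4: "distinct hall_list4"
  by (simp add: hall_list4_def lnorm_def)

text \<open>Enumeration by length, used only to prove \<open>hall_upto_4\<close> below.\<close>

fun hall_exact :: "nat \<Rightarrow> lie_mon list" where
  "hall_exact n = (if n = 1 then [Ltr LA, Ltr LB, Ltr LC] else
     filter hall (concat (map (\<lambda>k. map (\<lambda>(u, v). Br u v)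
       (List.product (hall_exact (n - k)) (hall_exact k))) [1..<n])))"

declare hall_exact.simps [simp del]

lemma lie_length_pos: "lie_length h \<ge> 1"
  by (induction h) auto

lemma set_hall_exact: "set (hall_exact n) = {h. hall h \<and> lie_length h = n}"
proof (induction n rule: less_induct)
  case (less n)
  have "h \<in> set (hall_exact n) \<longleftrightarrow> hall h \<and> lie_length h = n" for h
  proof (cases h)
    case (Ltr x)
    then show ?thesis by (cases x) (auto simp: hall_exact.simps[of n])
  next
    case (Br u v)
    have len: "lie_length u \<ge> 1" "lie_length v \<ge> 1" by (rule lie_length_pos)+
    show ?thesis
    proof (cases "n = 1")
      case True
      then show ?thesis using Br len by (auto simp: hall_exact.simps[of "Suc 0"])
    next
      case False
      have "h \<in> set (hall_exact n) \<longleftrightarrow> hall h \<and>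
          (\<exists>k\<in>{1..<n}. u \<in> set (hall_exact (n - k)) \<and> v \<in> set (hall_exact k))"
        using False Br by (auto simp: hall_exact.simps[of n])
      also have "\<dots> \<longleftrightarrow> hall h \<and>
          (\<exists>k\<in>{1..<n}. lie_length u = n - k \<and> lie_length v = k)"
        using less.IH Br by auto
      also have "\<dots> \<longleftrightarrow> hall h \<and> lie_length h = n"
        using Br len by auto
      finally show ?thesis .
    qed
  qed
  then show ?case by blast
qed

lemma hall_upto_4: "hall_upto 4 = set hall_list4"
proof -
  have "{h. hall h \<and> lie_length h \<le> 4} = (\<Union>n\<in>{1..4}. {h. hall h \<and> lie_length h = n})"
    using lie_length_pos by fastforce
  also have "{1..4} = {1, 2, 3, 4::nat}" by auto
  finally have "hall_upto 4 = set (hall_exact 1 @ hall_exact 2 @ hall_exact 3 @ hall_exact 4)"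
    unfolding hall_upto_def set_hall_exact[symmetric] by simp
  also have "\<dots> = set hall_list4" by code_simp
  finally show ?thesis .
qed

lemma card_hall_upto_4: "card (hall_upto 4) = 32"
  unfolding hall_upto_4 distinct_card[OF distinct_hall_list4] by (simp add: hall_list4_def)


section \<open>The Lie subalgebra generated by the three letters\<close>

definition aw_lie :: "'k::field \<Rightarrow> 'k free_alg set set" where
  "aw_lie q = lie_generated (aw_scalars q) (aw_algebra q) (range (\<lambda>x. aw_proj q (gen x)))"

text \<open>The canonical map from the free Lie algebra is the restriction of \<^const>\<open>aw_proj\<close>.\<close>

definition std_monomial :: "'k::field \<Rightarrow> lie_mon \<Rightarrow> 'k free_alg set" where
  "std_monomial q h = aw_proj q (lie_eval h)"

definition aw_lie_upto :: "'k::field \<Rightarrow> nat \<Rightarrow> 'k free_alg set set" where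
  "aw_lie_upto q n =
     linear_span_in (aw_scalars q) (aw_algebra q) (aw_lie q) (std_monomial q ` hall_upto n)"

end

theory Submission
  imports Defs
begin

text \<open>
  \<open>\<Delta>\<close> acts by tridiagonal operators on functions on the integers: \<open>A\<close> is diagonal plus a shift, \<open>B\<close> is
  diagonal plus the opposite shift weighted by a Laurent polynomial \<open>\<phi>\<close> in \<open>K\<^sub>i = q\<^sup>2\<^sup>i\<close>, and \<open>C\<close> is then
  forced by \<open>\<gamma>\<close>.  A linear combination of Lie monomials that vanishes in \<open>\<Delta>\<close> acts as zero for
  all values of the free parameters of this family.  The family is scaled so that, after multiplying
  the generators by a parameter \<open>t\<close>, it extends polynomially to \<open>t = 0\<close>; the value at \<open>t = 0\<close> only sees
  the monomials of top length.  Three such limits are monomial: \<open>A\<close> is a shift \<open>X\<close>,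
  \<open>B = X\<^sup>-\<^sup>1 (m K + g)\<close>, and \<open>C\<close> is a multiple \<open>\<kappa>\<close> of \<open>K\<^sup>-\<^sup>1\<close>, \<open>A K\<^sup>-\<^sup>1\<close> or \<open>B K\<^sup>-\<^sup>1\<close>.  The power of \<open>\<kappa>\<close> and the
  total shift then separate the multidegrees, and each multidegree contains at most three Hall
  elements, which the three limits tell apart because \<open>q\<^sup>4 \<noteq> 1\<close>.
\<close>

section \<open>Actions of the free algebra by linear operators\<close>

type_synonym 'k operator = "(int \<Rightarrow> 'k) \<Rightarrow> int \<Rightarrow> 'k"

definition linear_operator :: "'k::field operator \<Rightarrow> bool" where
  "linear_operator T \<longleftrightarrow> (\<forall>c f g. T (\<lambda>i. c * f i + g i) = (\<lambda>i. c * T f i + T g i))"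

lemma linear_operatorD:
  "linear_operator T \<Longrightarrow> T (\<lambda>i. c * f i + g i) = (\<lambda>i. c * T f i + T g i)"
  by (simp add: linear_operator_def)

lemma linear_operator_zero:
  assumes "linear_operator T" shows "T (\<lambda>i. 0) = (\<lambda>i. 0)"
  using linear_operatorD[OF assms, of "-1" "\<lambda>i. 0" "\<lambda>i. 0"] by simp

lemma linear_operator_scale:
  assumes "linear_operator T" shows "T (\<lambda>i. c * f i) = (\<lambda>i. c * T f i)"
  using linear_operatorD[OF assms, of c f "\<lambda>i. 0"] linear_operator_zero[OF assms] by simp

lemma linear_operator_sum:
  assumes "linear_operator T"
  shows "T (\<lambda>i. \<Sum>s\<in>S. c s * f s i) = (\<lambda>i. \<Sum>s\<in>S. c s * T (f s) i)"
  by (induction S rule: infinite_finite_induct)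
     (simp_all add: linear_operatorD[OF assms] linear_operator_zero[OF assms])

lemma linear_operator_scaled:
  assumes "linear_operator T" shows "linear_operator (\<lambda>f i. c * T f i)"
  unfolding linear_operator_def linear_operatorD[OF assms] by (simp add: algebra_simps)

text \<open>With \<open>foldr\<close> the rightmost letter acts first, so concatenation of words
  becomes composition and functions form a left module.\<close>

primrec act :: "(letter \<Rightarrow> 'k::field operator) \<Rightarrow> word \<Rightarrow> 'k operator" where
  "act \<rho> (Word xs) = foldr \<rho> xs"

definition alg_act :: "(letter \<Rightarrow> 'k::field operator) \<Rightarrow> 'k free_alg \<Rightarrow> 'k operator" where
  "alg_act \<rho> x f i = (\<Sum>w\<in>Poly_Mapping.keys x. Poly_Mapping.lookup x w * act \<rho> w f i)"

lemma act_plus: "act \<rho> (v + w) f = act \<rho> v (act \<rho> w f)"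
  by (cases v; cases w) simp

lemma act_zero: "act \<rho> 0 f = f"
  by (simp add: zero_word_def)

lemma linear_act:
  assumes "\<And>x. linear_operator (\<rho> x)"
  shows "linear_operator (act \<rho> w)"
proof (cases w)
  case (Word xs)
  have "linear_operator (foldr \<rho> xs)"
    by (induction xs) (simp_all add: linear_operator_def linear_operatorD[OF assms])
  then show ?thesis using Word by simp
qed

text \<open>Cancellation can shrink the support of a sum, so sums are compared over a common finite
  set of words.\<close>

lemma alg_act_superset:
  assumes "finite S" "Poly_Mapping.keys x \<subseteq> S"
  shows "alg_act \<rho> x f i = (\<Sum>w\<in>S. Poly_Mapping.lookup x w * act \<rho> w f i)"
  unfolding alg_act_def using assms
  by (intro sum.mono_neutral_left) (auto simp: in_keys_iff)

lemma alg_act_zero: "alg_act \<rho> 0 f = (\<lambda>i. 0)"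
  by (simp add: alg_act_def fun_eq_iff)

lemma alg_act_single: "alg_act \<rho> (Poly_Mapping.single w c) f = (\<lambda>i. c * act \<rho> w f i)"
  by (simp add: alg_act_def fun_eq_iff)

lemma alg_act_add: "alg_act \<rho> (x + y) f = (\<lambda>i. alg_act \<rho> x f i + alg_act \<rho> y f i)"
proof
  fix i
  let ?S = "Poly_Mapping.keys x \<union> Poly_Mapping.keys y"
  have "alg_act \<rho> z f i = (\<Sum>w\<in>?S. Poly_Mapping.lookup z w * act \<rho> w f i)" if "z \<in> {x, y, x + y}" for z
    using that keys_add[of x y] by (intro alg_act_superset) auto
  then show "alg_act \<rho> (x + y) f i = alg_act \<rho> x f i + alg_act \<rho> y f i"
    by (simp add: lookup_add distrib_right sum.distrib)
qed

lemma alg_act_uminus: "alg_act \<rho> (- x) f = (\<lambda>i. - alg_act \<rho> x f i)"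
  using alg_act_add[of \<rho> "- x" x f] by (simp add: alg_act_zero fun_eq_iff eq_neg_iff_add_eq_0)

lemma alg_act_diff: "alg_act \<rho> (x - y) f = (\<lambda>i. alg_act \<rho> x f i - alg_act \<rho> y f i)"
  using alg_act_add[of \<rho> x "- y" f] by (simp add: alg_act_uminus)

lemma alg_act_sum: "alg_act \<rho> (sum x S) f = (\<lambda>i. \<Sum>s\<in>S. alg_act \<rho> (x s) f i)"
  by (induction S rule: infinite_finite_induct) (simp_all add: alg_act_zero alg_act_add)

lemma free_alg_eq_sum_single:
  "x = (\<Sum>w\<in>Poly_Mapping.keys x. Poly_Mapping.single w (Poly_Mapping.lookup x w))"
  by (rule poly_mapping_eqI)
     (simp add: lookup_sum lookup_single when_def in_keys_iff if_distrib sum.delta cong: if_cong)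

lemma linear_alg_act:
  assumes "\<And>x. linear_operator (\<rho> x)"
  shows "linear_operator (alg_act \<rho> x)"
  unfolding linear_operator_def
  by (simp add: fun_eq_iff alg_act_def linear_operatorD[OF linear_act[OF assms]]
      sum.distrib sum_distrib_left distrib_left mult.left_commute)

text \<open>Both factors are expanded into words; linearity lets a word of the left factor pass
  through the sum for the right factor.\<close>

lemma alg_act_mult:
  assumes "\<And>x. linear_operator (\<rho> x)"
  shows "alg_act \<rho> (x * y) f = alg_act \<rho> x (alg_act \<rho> y f)"
proof -
  have single: "alg_act \<rho> (Poly_Mapping.single v c * y) f
      = alg_act \<rho> (Poly_Mapping.single v c) (alg_act \<rho> y f)" for v c
  proof -
    have "Poly_Mapping.single v c * y
        = (\<Sum>w\<in>Poly_Mapping.keys y. Poly_Mapping.single (v + w) (c * Poly_Mapping.lookup y w))"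
      by (subst (1) free_alg_eq_sum_single[of y]) (simp add: sum_distrib_left mult_single)
    then show ?thesis
      by (simp add: alg_act_sum alg_act_single act_plus alg_act_def[of \<rho> y, abs_def]
          linear_operator_sum[OF linear_act[OF assms]] sum_distrib_left mult.assoc)
  qed
  have "x * y = (\<Sum>w\<in>Poly_Mapping.keys x. Poly_Mapping.single w (Poly_Mapping.lookup x w) * y)"
    by (subst (1) free_alg_eq_sum_single[of x]) (simp add: sum_distrib_right)
  also have "alg_act \<rho> \<dots> f
      = alg_act \<rho> (\<Sum>w\<in>Poly_Mapping.keys x. Poly_Mapping.single w (Poly_Mapping.lookup x w)) (alg_act \<rho> y f)"
    by (simp add: alg_act_sum single)
  finally show ?thesis
    by (simp flip: free_alg_eq_sum_single)
qed

lemma alg_act_gen: "alg_act \<rho> (gen x) f = \<rho> x f"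
  by (simp add: gen_def alg_act_single)

lemma alg_act_scal: "alg_act \<rho> (scal c) f = (\<lambda>i. c * f i)"
  by (simp add: scal_def alg_act_single act_zero)

text \<open>Left multiples stay in the set because linear operators send 0 to 0, right multiples
  because annihilation is required for every \<open>f\<close>.\<close>

lemma ideal_annihilator:
  "ideal {x. \<forall>f. alg_act \<rho> x f = (\<lambda>i. 0)} ring_of_type_algebra"
  if lin: "\<And>x. linear_operator (\<rho> x :: 'k::field operator)"
proof (rule idealI)
  interpret ring "ring_of_type_algebra :: 'k free_alg ring" by (rule ring_free_alg)
  show "ring (ring_of_type_algebra :: 'k free_alg ring)" by (rule ring_free_alg)
  let ?I = "{x. \<forall>f. alg_act \<rho> x f = (\<lambda>i. 0)}"
  show "subgroup ?I (add_monoid ring_of_type_algebra)"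
  proof (rule add.subgroupI)
    fix x assume x: "x \<in> ?I"
    have "\<ominus>\<^bsub>ring_of_type_algebra\<^esub> x = - x"
      by (rule minus_equality) (simp_all add: ring_of_type_algebra_def)
    then show "\<ominus>\<^bsub>ring_of_type_algebra\<^esub> x \<in> ?I" using x by (simp add: alg_act_uminus)
  qed (auto simp: ring_of_type_algebra_def alg_act_add intro!: exI[of _ 0] alg_act_zero)
qed (simp_all add: ring_of_type_algebra_def alg_act_mult[OF lin]
      linear_operator_zero[OF linear_alg_act[OF lin]])

text \<open>Where \<alpha>, \<beta>, \<gamma> act as scalars, their commutators with the generators
  act as zero; the annihilator then contains the relators and hence the ideal.\<close>

lemma alg_act_aw_ideal:
  fixes \<rho> :: "letter \<Rightarrow> 'k::field operator"
  assumes lin: "\<And>x. linear_operator (\<rho> x)"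
    and central: "\<And>d. d \<in> {aw_alpha q, aw_beta q, aw_gamma q} \<Longrightarrow>
                    \<exists>c. \<forall>f. alg_act \<rho> d f = (\<lambda>i. c * f i)"
    and x: "x \<in> aw_ideal q"
  shows "alg_act \<rho> x f = (\<lambda>i. 0)"
proof -
  have "aw_relators q \<subseteq> {x. \<forall>f. alg_act \<rho> x f = (\<lambda>i. 0)}"
  proof
    fix r assume "r \<in> aw_relators q"
    then obtain x d where r: "r = comm (gen x) d" and "d \<in> {aw_alpha q, aw_beta q, aw_gamma q}"
      unfolding aw_relators_def by blast
    then obtain c where "\<And>f. alg_act \<rho> d f = (\<lambda>i. c * f i)" using central by blast
    then show "r \<in> {x. \<forall>f. alg_act \<rho> x f = (\<lambda>i. 0)}"
      unfolding r comm_def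
      by (simp add: alg_act_diff alg_act_mult[OF lin] alg_act_gen linear_operator_scale[OF lin])
  qed
  then have "aw_ideal q \<subseteq> {x. \<forall>f. alg_act \<rho> x f = (\<lambda>i. 0)}"
    unfolding aw_ideal_def
    by (rule ring.genideal_minimal[OF ring_free_alg ideal_annihilator[OF lin]])
  with x show ?thesis by blast
qed

primrec lie_act :: "(letter \<Rightarrow> 'k::field operator) \<Rightarrow> lie_mon \<Rightarrow> 'k operator" where
  "lie_act \<rho> (Ltr x) f = \<rho> x f"
| "lie_act \<rho> (Br u v) f = (\<lambda>i. lie_act \<rho> u (lie_act \<rho> v f) i - lie_act \<rho> v (lie_act \<rho> u f) i)"

lemma alg_act_lie_eval:
  assumes "\<And>x. linear_operator (\<rho> x)"
  shows "alg_act \<rho> (lie_eval h) f = lie_act \<rho> h f"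
  by (induction h arbitrary: f) (simp_all add: alg_act_gen comm_def alg_act_diff alg_act_mult[OF assms])

lemma linear_lie_act:
  assumes "\<And>x. linear_operator (\<rho> x)"
  shows "linear_operator (lie_act \<rho> h)"
  using linear_alg_act[where x = "lie_eval h", OF assms]
  by (simp add: linear_operator_def alg_act_lie_eval[OF assms])

lemma lie_act_scale:
  assumes "\<And>x. linear_operator (\<rho> x)"
  shows "lie_act (\<lambda>x f i. c * \<rho> x f i) h f = (\<lambda>i. c ^ lie_length h * lie_act \<rho> h f i)"
  by (induction h arbitrary: f)
     (simp_all add: linear_operator_scale[OF linear_lie_act[OF assms]] power_add algebra_simps)


section \<open>A family of tridiagonal representations\<close>

locale aw =
  fixes q :: "'k::field"
  assumes q_nonzero: "q \<noteq> 0" and q4_neq_1: "q ^ 4 \<noteq> 1"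
begin

definition K :: "int \<Rightarrow> 'k" where "K i = q powi (2 * i)"

lemma K_nonzero: "K i \<noteq> 0"
  by (simp add: K_def q_nonzero)

lemma K_0: "K 0 = 1"
  by (simp add: K_def)

lemma K_plus_1: "K (i + 1) = q\<^sup>2 * K i"
  by (simp add: K_def q_nonzero power_int_add distrib_left)

lemma K_minus_1: "K (i - 1) = K i / q\<^sup>2"
  using K_plus_1[of "i - 1"] q_nonzero by (simp add: field_simps)

lemma q2_neq_1: "q\<^sup>2 \<noteq> 1"
proof
  assume "q\<^sup>2 = 1"
  then have "(q\<^sup>2)\<^sup>2 = 1" by simp
  then show False using q4_neq_1 by simp
qed

lemma q2_neq_minus_1: "q\<^sup>2 \<noteq> - 1"
proof
  assume "q\<^sup>2 = - 1"
  then have "(q\<^sup>2)\<^sup>2 = 1" by simp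
  then show False using q4_neq_1 by simp
qed

text \<open>
  The parameters satisfy \<open>a a' = t = b b'\<close>.  The generator \<open>x\<close> will act as \<open>t\<^sup>-\<^sup>1\<close> times \<open>tri \<dots> x\<close>.
  Up to the free parameters \<open>m\<close>, \<open>g\<close>, \<open>c\<close>, the function \<open>phi\<close> is the solution of the recurrence that
  makes \<open>\<alpha>\<close> and \<open>\<beta>\<close> scalar; the entries for \<open>C\<close> are obtained by solving the definition of \<open>\<gamma>\<close> for
  \<open>C\<close>, and the division by \<open>t\<close> this involves is exact.
\<close>

definition phi where
  "phi t a a' b b' c m g i = a * b / q\<^sup>2 * (K i)\<^sup>2 + m * K i + g + t * c / K i
     + t\<^sup>2 * a' * b' * q\<^sup>2 / (K i)\<^sup>2"

fun lower :: "'k \<Rightarrow> 'k \<Rightarrow> 'k \<Rightarrow> 'k \<Rightarrow> 'k \<Rightarrow> 'k \<Rightarrow> 'k \<Rightarrow> 'k \<Rightarrow> letter \<Rightarrow> int \<Rightarrow> 'k" where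
  "lower t a a' b b' c m g LA i = 1"
| "lower t a a' b b' c m g LB i = 0"
| "lower t a a' b b' c m g LC i = - b' / q / K (i - 1)"

fun diagonal :: "'k \<Rightarrow> 'k \<Rightarrow> 'k \<Rightarrow> 'k \<Rightarrow> 'k \<Rightarrow> 'k \<Rightarrow> 'k \<Rightarrow> 'k \<Rightarrow> letter \<Rightarrow> int \<Rightarrow> 'k" where
  "diagonal t a a' b b' c m g LA i = a * K i + t * a' / K i"
| "diagonal t a a' b b' c m g LB i = b * K i + t * b' / K i"
| "diagonal t a a' b b' c m g LC i = - c / q / K i - t * a' * b' * (q + 1 / q) / (K i)\<^sup>2"

fun upper :: "'k \<Rightarrow> 'k \<Rightarrow> 'k \<Rightarrow> 'k \<Rightarrow> 'k \<Rightarrow> 'k \<Rightarrow> 'k \<Rightarrow> 'k \<Rightarrow> letter \<Rightarrow> int \<Rightarrow> 'k" where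
  "upper t a a' b b' c m g LA i = 0"
| "upper t a a' b b' c m g LB i = phi t a a' b b' c m g (i + 1)"
| "upper t a a' b b' c m g LC i = - a' * q * phi t a a' b b' c m g (i + 1) / K (i + 1)"

definition tri where
  "tri t a a' b b' c m g x f i = lower t a a' b b' c m g x i * f (i - 1)
     + diagonal t a a' b b' c m g x i * f i + upper t a a' b b' c m g x i * f (i + 1)"

lemma linear_tri: "linear_operator (tri t a a' b b' c m g x)"
  unfolding linear_operator_def tri_def by (simp add: fun_eq_iff algebra_simps)

lemma K_shift: "K (i + 1 + 1) = q ^ 4 * K i" "K (i - 1 - 1) = K i / q ^ 4" "K (i - 1 + 1) = K i"
    "K (i + 1 - 1) = K i"
  using K_plus_1[of "i + 1"] K_plus_1[of i] K_minus_1[of "i - 1"] K_minus_1[of i]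
  by (simp_all add: power2_eq_square power4_eq_xxxx)

lemma tri_compose:
  fixes t a a' b b' c m g :: 'k
  defines "L \<equiv> lower t a a' b b' c m g" and "D \<equiv> diagonal t a a' b b' c m g"
    and "U \<equiv> upper t a a' b b' c m g"
  shows "tri t a a' b b' c m g x (tri t a a' b b' c m g y f) i =
    L x i * L y (i - 1) * f (i - 2)
    + (L x i * D y (i - 1) + D x i * L y i) * f (i - 1)
    + (L x i * U y (i - 1) + D x i * D y i + U x i * L y (i + 1)) * f i
    + (D x i * U y i + U x i * D y (i + 1)) * f (i + 1)
    + U x i * U y (i + 1) * f (i + 2)"
  unfolding tri_def assms[symmetric]
  by (simp add: algebra_simps)

text \<open>The left side is \<open>(q - 1/q) * t^2\<close> times the action of
  \<open>aw_elt\<close> when each generator acts as \<open>T / t\<close>. The five hypotheses are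
  its coefficients at \<open>f (i - 2)\<close> to \<open>f (i + 2)\<close>; only the middle one may
  be nonzero.\<close>

lemma tri_central:
  fixes t a a' b b' c m g e :: 'k
  defines "L \<equiv> lower t a a' b b' c m g" and "D \<equiv> diagonal t a a' b b' c m g"
    and "U \<equiv> upper t a a' b b' c m g"
  assumes "q * (L y i * L z (i - 1)) - L z i * L y (i - 1) / q = 0"
    and "(q\<^sup>2 - 1 / q\<^sup>2) * t * L x i + q * (L y i * D z (i - 1) + D y i * L z i)
      - (L z i * D y (i - 1) + D z i * L y i) / q = 0"
    and "(q\<^sup>2 - 1 / q\<^sup>2) * t * D x i
      + q * (L y i * U z (i - 1) + D y i * D z i + U y i * L z (i + 1))
      - (L z i * U y (i - 1) + D z i * D y i + U z i * L y (i + 1)) / q = e"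
    and "(q\<^sup>2 - 1 / q\<^sup>2) * t * U x i + q * (D y i * U z i + U y i * D z (i + 1))
      - (D z i * U y i + U z i * D y (i + 1)) / q = 0"
    and "q * (U y i * U z (i + 1)) - U z i * U y (i + 1) / q = 0"
  defines "T \<equiv> tri t a a' b b' c m g"
  shows "(q\<^sup>2 - 1 / q\<^sup>2) * t * T x f i + (q * T y (T z f) i - T z (T y f) i / q) = e * f i"
proof -
  have "(q\<^sup>2 - 1 / q\<^sup>2) * t * T x f i + (q * T y (T z f) i - T z (T y f) i / q) =
     (q * (L y i * L z (i - 1)) - L z i * L y (i - 1) / q) * f (i - 2)
   + ((q\<^sup>2 - 1 / q\<^sup>2) * t * L x i + q * (L y i * D z (i - 1) + D y i * L z i)
      - (L z i * D y (i - 1) + D z i * L y i) / q) * f (i - 1)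
   + ((q\<^sup>2 - 1 / q\<^sup>2) * t * D x i
      + q * (L y i * U z (i - 1) + D y i * D z i + U y i * L z (i + 1))
      - (L z i * U y (i - 1) + D z i * D y i + U z i * L y (i + 1)) / q) * f i
   + ((q\<^sup>2 - 1 / q\<^sup>2) * t * U x i + q * (D y i * U z i + U y i * D z (i + 1))
      - (D z i * U y i + U z i * D y (i + 1)) / q) * f (i + 1)
   + (q * (U y i * U z (i + 1)) - U z i * U y (i + 1) / q) * f (i + 2)"
    unfolding T_def tri_compose L_def[symmetric] D_def[symmetric] U_def[symmetric]
    unfolding tri_def L_def[symmetric] D_def[symmetric] U_def[symmetric]
    by (simp add: ring_distribs add_divide_distrib mult.assoc)
  then show ?thesis unfolding assms(4-8) by simp
qed

context
  fixes t a a' b b' c m g :: 'k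
  assumes t: "t \<noteq> 0" and a: "a * a' = t" and b: "b * b' = t"
begin

lemma tri_alpha_beta_gamma:
  defines "T \<equiv> tri t a a' b b' c m g"
  shows "(q\<^sup>2 - 1 / q\<^sup>2) * t * T LA f i + (q * T LB (T LC f) i - T LC (T LB f) i / q)
       = (- b' * m * (q\<^sup>2 - 1) - b * c * (1 - 1 / q\<^sup>2)) * f i" (is ?alpha)
    and "(q\<^sup>2 - 1 / q\<^sup>2) * t * T LB f i + (q * T LC (T LA f) i - T LA (T LC f) i / q)
       = (- a' * m * (q\<^sup>2 - 1) - a * c * (1 - 1 / q\<^sup>2)) * f i" (is ?beta)
    and "(q\<^sup>2 - 1 / q\<^sup>2) * t * T LC f i + (q * T LA (T LB f) i - T LB (T LA f) i / q)
       = (q - 1 / q) * (g + t * (a * b' + a' * b)) * f i" (is ?gamma)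
proof -
  have nz: "a' \<noteq> 0" "b' \<noteq> 0" using t a b by auto
  \<comment> \<open>Eliminating \<open>a\<close> and \<open>b\<close> removes the two constraints,
    so that each of the fifteen coefficients becomes a rational identity.\<close>
  then have ab: "a = t / a'" "b = t / b'" using a b by (simp_all add: eq_divide_eq)
  define z where "z = K i"
  have z: "z \<noteq> 0" by (simp add: z_def K_nonzero)
  define r where "r = phi t a a' b b' c m g (i + 1)"
  \<comment> \<open>This value can stay opaque: it occurs only at \<open>f (i + 2)\<close> in
    \<alpha>, in two terms that cancel.\<close>
  define r' where "r' = phi t a a' b b' c m g (i + 1 + 1)"
  have r_eq: "phi t a a' b b' c m g (i + 1 - 1) = phi t a a' b b' c m g i"
    "phi t a a' b b' c m g (i - 1 + 1) = phi t a a' b b' c m g i" by simp_all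
  note z_eq = K_shift K_plus_1 K_minus_1 z_def[symmetric]
  note entries = lower.simps diagonal.simps upper.simps r_eq r_def[symmetric] r'_def[symmetric] z_eq
  note nz = nz z q_nonzero
  have phi_eq: "phi t a a' b b' c m g i = t * t / (a' * b') / q\<^sup>2 * z\<^sup>2 + m * z + g + t * c / z
      + t\<^sup>2 * a' * b' * q\<^sup>2 / z\<^sup>2"
    "r = t * t / (a' * b') * q\<^sup>2 * z\<^sup>2 + m * q\<^sup>2 * z + g + t * c / (q\<^sup>2 * z)
      + t\<^sup>2 * a' * b' / (q\<^sup>2 * z\<^sup>2)"
    unfolding r_def phi_def z_eq ab using nz
    by (simp_all add: field_simps power_numeral_reduce)
  show ?alpha ?beta ?gamma
    unfolding T_def
    by (rule tri_central; (simp only: entries; (simp only: phi_eq)?; (simp only: ab)?);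
        insert nz; ((simp add: field_simps power_numeral_reduce; fail)
          | (simp add: field_simps power_numeral_reduce power2_eq_square; fail)))+
qed

end

end


section \<open>Limits of the representations\<close>

text \<open>Only the existence of a polynomial is asserted, so closure under arithmetic works by
  introduction rules and no polynomial for a Lie monomial has to be written down.\<close>

definition poly_function :: "('k::comm_ring_1 \<Rightarrow> 'k) \<Rightarrow> bool" where
  "poly_function F \<longleftrightarrow> (\<exists>p. \<forall>s. F s = poly p s)"

lemma poly_function_const: "poly_function (\<lambda>s. c)"
  unfolding poly_function_def by (rule exI[of _ "[:c:]"]) auto

lemma poly_function_id: "poly_function (\<lambda>s. s)"
  unfolding poly_function_def by (rule exI[of _ "[:0, 1:]"]) auto

lemma poly_function_add:
  "poly_function F \<Longrightarrow> poly_function G \<Longrightarrow> poly_function (\<lambda>s. F s + G s)"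
  unfolding poly_function_def by (metis poly_add)

lemma poly_function_diff:
  "poly_function F \<Longrightarrow> poly_function G \<Longrightarrow> poly_function (\<lambda>s. F s - G s)"
  unfolding poly_function_def by (metis poly_diff)

lemma poly_function_minus:
  "poly_function F \<Longrightarrow> poly_function (\<lambda>s. - F s)"
  unfolding poly_function_def by (metis poly_minus)

lemma poly_function_mult:
  "poly_function F \<Longrightarrow> poly_function G \<Longrightarrow> poly_function (\<lambda>s. F s * G s)"
  unfolding poly_function_def by (metis poly_mult)

lemma poly_function_divide:
  "poly_function F \<Longrightarrow> poly_function (\<lambda>s. F s / c)" for c :: "'k::field"
  using poly_function_mult[OF _ poly_function_const[of "inverse c"]] by (simp add: divide_inverse)

lemma poly_function_power:
  "poly_function F \<Longrightarrow> poly_function (\<lambda>s. F s ^ n)"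
  unfolding poly_function_def by (metis poly_power)

lemma poly_function_sum:
  "(\<And>h. h \<in> S \<Longrightarrow> poly_function (F h)) \<Longrightarrow> poly_function (\<lambda>s. \<Sum>h\<in>S. F h s)"
  by (induction S rule: infinite_finite_induct)
     (auto intro: poly_function_add poly_function_const)

lemmas poly_function_intros = poly_function_const poly_function_id poly_function_add
  poly_function_diff poly_function_minus poly_function_mult poly_function_divide
  poly_function_power poly_function_sum

text \<open>Over a finite field, the product of all \<open>X - x\<close>, plus 1, would be a
  nonconstant polynomial without roots.\<close>

lemma infinite_UNIV_alg_closed_field: "infinite (UNIV :: 'k::alg_closed_field set)"
proof
  assume fin: "finite (UNIV :: 'k set)"
  define p :: "'k poly" where "p = (\<Prod>x\<in>UNIV. [:- x, 1:]) + 1"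
  have "degree (\<Prod>x\<in>(UNIV::'k set). [:- x, 1:]) = card (UNIV :: 'k set)"
    by (subst degree_prod_eq_sum_degree) auto
  moreover have "card (UNIV :: 'k set) > 0" using fin by (simp add: card_gt_0_iff)
  ultimately have "degree p > 0"
    unfolding p_def by (subst degree_add_eq_left) auto
  then obtain x where "poly p x = 0" using alg_closed_imp_poly_has_root by blast
  moreover have "poly p x = 1"
    unfolding p_def using fin by (simp add: poly_prod prod_zero[of UNIV])
  ultimately show False by simp
qed

lemma poly_zero_if_zero_off_0:
  fixes p :: "'k::alg_closed_field poly"
  assumes "\<And>s. s \<noteq> 0 \<Longrightarrow> poly p s = 0"
  shows "p = 0"
proof (rule ccontr)
  assume "p \<noteq> 0"
  then have "finite {s. poly p s = 0}" by (rule poly_roots_finite)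
  moreover have "UNIV - {0} \<subseteq> {s. poly p s = 0}" using assms by auto
  ultimately have "finite (UNIV - {0 :: 'k})" by (rule rev_finite_subset)
  then show False using infinite_UNIV_alg_closed_field[where 'k = 'k] by simp
qed

text \<open>This replaces the passage to the limit: an identity valid for all nonzero
  \<open>s\<close> extends to \<open>s = 0\<close>.\<close>

lemma poly_function_zero:
  fixes F :: "'k::alg_closed_field \<Rightarrow> 'k"
  assumes "poly_function F" "\<And>s. s \<noteq> 0 \<Longrightarrow> F s = 0"
  shows "F s = 0"
proof -
  obtain p where p: "\<And>s. F s = poly p s" using assms(1) unfolding poly_function_def by blast
  have "p = 0" by (rule poly_zero_if_zero_off_0) (use assms(2) p in auto)
  then show ?thesis by (simp add: p)
qed

lemma power_sum_coeff_zero: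
  fixes r :: "'h \<Rightarrow> 'k::alg_closed_field"
  assumes "finite S" "\<And>s. s \<noteq> 0 \<Longrightarrow> (\<Sum>h\<in>S. r h * s ^ e h) = 0"
  shows "(\<Sum>h\<in>{h\<in>S. e h = d}. r h) = 0"
proof -
  define p where "p = (\<Sum>h\<in>S. monom (r h) (e h))"
  have "p = 0"
    by (rule poly_zero_if_zero_off_0) (use assms in \<open>simp add: p_def poly_sum poly_monom\<close>)
  then have "coeff p d = 0" by simp
  then show ?thesis
    using assms(1) by (simp add: p_def coeff_sum sum.If_cases Int_def)
qed

text \<open>The argument \<open>f\<close> depends on \<open>s\<close> because in a bracket one
  operator is applied to the output of another.\<close>

lemma poly_function_lie_act:
  fixes \<rho> :: "'k::field \<Rightarrow> letter \<Rightarrow> 'k operator"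
  assumes "\<And>x f i. (\<And>i. poly_function (\<lambda>s. f s i)) \<Longrightarrow> poly_function (\<lambda>s. \<rho> s x (f s) i)"
    and "\<And>i. poly_function (\<lambda>s. f s i)"
  shows "poly_function (\<lambda>s. lie_act (\<rho> s) h (f s) i)"
  using assms(2)
proof (induction h arbitrary: f i)
  case (Ltr x)
  then show ?case using assms(1) by simp
next
  case (Br u v)
  then show ?case by (simp add: poly_function_diff)
qed

lemma alg_act_aw_elt:
  assumes "\<And>x. linear_operator (\<rho> x)"
  shows "alg_act \<rho> (aw_elt q (gen x) (gen y) (gen z)) f = (\<lambda>i. (q + inverse q) * \<rho> x f i
     + inverse (q - inverse q) * (q * \<rho> y (\<rho> z f) i - inverse q * \<rho> z (\<rho> y f) i))"
  by (simp add: aw_elt_def alg_act_add alg_act_diff alg_act_mult[OF assms] alg_act_scal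
      alg_act_gen linear_operator_scale[OF assms])

section \<open>Relations modulo the ideal, evaluated in the representations\<close>

context aw
begin

lemma q_minus_inverse_nonzero: "q - inverse q \<noteq> 0"
  using q2_neq_1 q_nonzero by (auto simp: field_simps power2_eq_square)

text \<open>Since \<open>q + 1/q = (q^2 - 1/q^2) / (q - 1/q)\<close>, the action of
  \<open>aw_elt\<close> is the left side of \<open>e\<close> divided by
  \<open>(q - 1/q) * t^2\<close>.\<close>

lemma aw_elt_central:
  assumes lin: "\<And>x. linear_operator (\<rho> x)" and t: "t \<noteq> 0"
    and e: "\<And>f i. (q\<^sup>2 - 1 / q\<^sup>2) * t * \<rho> x f i + (q * \<rho> y (\<rho> z f) i - \<rho> z (\<rho> y f) i / q) = e * f i"
  shows "\<exists>e. \<forall>f. alg_act (\<lambda>x f i. inverse t * \<rho> x f i) (aw_elt q (gen x) (gen y) (gen z)) f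
                   = (\<lambda>i. e * f i)"
proof -
  define \<sigma> where "\<sigma> = (\<lambda>x f i. inverse t * \<rho> x f i)"
  have lin': "linear_operator (\<sigma> x)" for x
    unfolding \<sigma>_def by (rule linear_operator_scaled[OF lin])
  have comp: "\<sigma> x (\<sigma> y f) i = inverse t * inverse t * \<rho> x (\<rho> y f) i" for x y f i
    unfolding \<sigma>_def by (simp add: linear_operator_scale[OF lin])
  have "alg_act \<sigma> (aw_elt q (gen x) (gen y) (gen z)) f i
      = inverse t * inverse t * inverse (q - inverse q) * e * f i" for f i
  proof -
    define d where "d = inverse (q - inverse q)"
    define Q where "Q = q\<^sup>2 - 1 / q\<^sup>2"
    have "(q + inverse q) * (q - inverse q) = q\<^sup>2 - 1 / q\<^sup>2"
      using q_nonzero by (simp add: field_simps power2_eq_square)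
    then have "q + inverse q = d * Q"
      using q_minus_inverse_nonzero by (simp add: d_def Q_def field_simps)
    then have "alg_act \<sigma> (aw_elt q (gen x) (gen y) (gen z)) f i = d * Q * \<sigma> x f i
        + d * (q * (inverse t * inverse t * \<rho> y (\<rho> z f) i)
          - inverse q * (inverse t * inverse t * \<rho> z (\<rho> y f) i))"
      by (simp add: alg_act_aw_elt[OF lin'] comp d_def)
    also have "\<dots> = inverse t * inverse t * d
        * (Q * t * \<rho> x f i + (q * \<rho> y (\<rho> z f) i - \<rho> z (\<rho> y f) i / q))"
      using t q_nonzero by (simp add: \<sigma>_def field_simps)
    finally show ?thesis unfolding Q_def d_def e by (simp only: mult.assoc)
  qed
  then show ?thesis by (auto simp: \<sigma>_def fun_eq_iff)
qed

lemma lie_act_tri_aw_ideal: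
  assumes t: "t \<noteq> 0" and ab: "a * a' = t" "b * b' = t"
    and x: "(\<Sum>h\<in>S. scal (r h) * lie_eval h) \<in> aw_ideal q"
  shows "(\<Sum>h\<in>S. r h * inverse t ^ lie_length h * lie_act (tri t a a' b b' c m g) h f i) = 0"
proof -
  let ?T = "tri t a a' b b' c m g"
  let ?\<rho> = "\<lambda>x f i. inverse t * ?T x f i"
  have lin: "linear_operator (?\<rho> x)" for x
    by (rule linear_operator_scaled[OF linear_tri])
  have "\<exists>e. \<forall>f. alg_act ?\<rho> d f = (\<lambda>i. e * f i)" if "d \<in> {aw_alpha q, aw_beta q, aw_gamma q}" for d
  proof -
    have "\<exists>e. \<forall>f. alg_act ?\<rho> (aw_alpha q) f = (\<lambda>i. e * f i)"
      unfolding aw_alpha_def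
      by (rule aw_elt_central[OF linear_tri t tri_alpha_beta_gamma(1)[OF t ab]])
    moreover have "\<exists>e. \<forall>f. alg_act ?\<rho> (aw_beta q) f = (\<lambda>i. e * f i)"
      unfolding aw_beta_def
      by (rule aw_elt_central[OF linear_tri t tri_alpha_beta_gamma(2)[OF t ab]])
    moreover have "\<exists>e. \<forall>f. alg_act ?\<rho> (aw_gamma q) f = (\<lambda>i. e * f i)"
      unfolding aw_gamma_def
      by (rule aw_elt_central[OF linear_tri t tri_alpha_beta_gamma(3)[OF t ab]])
    ultimately show ?thesis using that by blast
  qed
  then have "alg_act ?\<rho> (\<Sum>h\<in>S. scal (r h) * lie_eval h) f = (\<lambda>i. 0)"
    by (rule alg_act_aw_ideal[OF lin _ x])
  then have "alg_act ?\<rho> (\<Sum>h\<in>S. scal (r h) * lie_eval h) f i = 0" by (rule fun_cong)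
  then show ?thesis
    by (simp add: alg_act_sum alg_act_mult[OF lin] alg_act_scal alg_act_lie_eval[OF lin]
        lie_act_scale[OF linear_tri] mult.assoc)
qed

end

locale aw_closed = aw q for q :: "'k::alg_closed_field"
begin

text \<open>
  The substitution \<open>t = s\<^sup>2\<close> allows both factors of \<open>a a' = t\<close> to vanish at \<open>s = 0\<close>, as well as \<open>a'\<close> to
  be a nonzero constant, which is what distinguishes the three limits.
\<close>

lemma lie_act_limit:
  fixes a a' b b' :: "'k \<Rightarrow> 'k" and c m g :: 'k
  assumes fin: "finite S" and x: "(\<Sum>h\<in>S. scal (r h) * lie_eval h) \<in> aw_ideal q"
    and len: "\<And>h. h \<in> S \<Longrightarrow> n < lie_length h \<Longrightarrow> r h = 0"
    and poly: "poly_function a" "poly_function a'" "poly_function b" "poly_function b'"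
    and ab: "\<And>s. a s * a' s = s\<^sup>2" "\<And>s. b s * b' s = s\<^sup>2"
  shows "(\<Sum>h\<in>{h\<in>S. lie_length h = n}. r h * lie_act (tri 0 (a 0) (a' 0) (b 0) (b' 0) c m g) h f i) = 0"
proof -
  let ?T = "\<lambda>s. tri (s\<^sup>2) (a s) (a' s) (b s) (b' s) c m g"
  \<comment> \<open>The relation is multiplied by \<open>t ^ n\<close> with \<open>t = s^2\<close>
    to clear negative powers of \<open>t\<close>. Truncated subtraction is harmless, as
    \<open>r h = 0\<close> for monomials longer than \<open>n\<close>.\<close>
  define F where "F s = (\<Sum>h\<in>S. r h * (s\<^sup>2) ^ (n - lie_length h) * lie_act (?T s) h f i)" for s
  have T: "poly_function (\<lambda>s. ?T s x (f s) i)" if "\<And>i. poly_function (\<lambda>s. f s i)" for x f i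
    unfolding tri_def
    by (cases x; simp only: lower.simps diagonal.simps upper.simps phi_def;
        intro poly_function_intros poly that)
  have "poly_function F"
    unfolding F_def
  proof (rule poly_function_sum)
    fix h
    have "poly_function (\<lambda>s. lie_act (?T s) h f i)"
      by (rule poly_function_lie_act[OF T poly_function_const])
    then show "poly_function (\<lambda>s. r h * (s\<^sup>2) ^ (n - lie_length h) * lie_act (?T s) h f i)"
      by (intro poly_function_mult poly_function_power poly_function_const poly_function_id)
  qed
  moreover have "F s = 0" if s: "s \<noteq> 0" for s
  proof -
    have "F s = (\<Sum>h\<in>S. (s\<^sup>2) ^ n * (r h * inverse (s\<^sup>2) ^ lie_length h * lie_act (?T s) h f i))"
      unfolding F_def
    proof (rule sum.cong[OF refl])
      fix h assume h: "h \<in> S"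
      have "(s\<^sup>2) ^ (n - lie_length h) = (s\<^sup>2) ^ n * inverse (s\<^sup>2) ^ lie_length h" if "lie_length h \<le> n"
        using that s by (simp add: power_diff power_inverse divide_inverse)
      then show "r h * (s\<^sup>2) ^ (n - lie_length h) * lie_act (?T s) h f i
          = (s\<^sup>2) ^ n * (r h * inverse (s\<^sup>2) ^ lie_length h * lie_act (?T s) h f i)"
        using len[OF h] by (cases "lie_length h \<le> n") auto
    qed
    also have "\<dots> = 0"
      using lie_act_tri_aw_ideal[OF _ ab x, of s c m g f i] s
      by (simp flip: sum_distrib_left)
    finally show ?thesis .
  qed
  ultimately have "F 0 = 0" by (rule poly_function_zero)
  moreover have "F 0 = (\<Sum>h\<in>S. if lie_length h = n
      then r h * lie_act (tri 0 (a 0) (a' 0) (b 0) (b' 0) c m g) h f i else 0)"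
    unfolding F_def
  proof (rule sum.cong[OF refl])
    fix h assume h: "h \<in> S"
    show "r h * (0\<^sup>2) ^ (n - lie_length h) * lie_act (?T 0) h f i
       = (if lie_length h = n
          then r h * lie_act (tri 0 (a 0) (a' 0) (b 0) (b' 0) c m g) h f i else 0)"
    proof (cases "lie_length h" n rule: linorder_cases)
      case less
      then have "n - lie_length h > 0" by simp
      then have "((0 :: 'k)\<^sup>2) ^ (n - lie_length h) = 0" by (metis zero_power zero_power2)
      then show ?thesis using less by (simp only: mult_zero_left mult_zero_right less_imp_neq if_False)
    next
      case greater
      then show ?thesis using len[OF h] by simp
    qed simp
  qed
  ultimately show ?thesis
    using fin by (simp add: sum.inter_filter)
qed

end


section \<open>Monomial limits and multidegrees\<close>

primrec lie_shift :: "(letter \<Rightarrow> int) \<Rightarrow> lie_mon \<Rightarrow> int" where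
  "lie_shift sh (Ltr x) = sh x"
| "lie_shift sh (Br u v) = lie_shift sh u + lie_shift sh v"

text \<open>The index is the source: the operator of \<open>h\<close> sends the delta function at
  \<open>i\<close> to \<open>lie_coeff sh F h i\<close> times the one at
  \<open>i + lie_shift sh h\<close>.\<close>

primrec lie_coeff :: "(letter \<Rightarrow> int) \<Rightarrow> (letter \<Rightarrow> int \<Rightarrow> 'k::field) \<Rightarrow> lie_mon \<Rightarrow> int \<Rightarrow> 'k" where
  "lie_coeff sh F (Ltr x) i = F x i"
| "lie_coeff sh F (Br u v) i = lie_coeff sh F u (i + lie_shift sh v) * lie_coeff sh F v i
     - lie_coeff sh F v (i + lie_shift sh u) * lie_coeff sh F u i"

primrec count_C :: "lie_mon \<Rightarrow> nat" where
  "count_C (Ltr x) = (if x = LC then 1 else 0)"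
| "count_C (Br u v) = count_C u + count_C v"

lemma lie_act_monomial:
  assumes "\<And>x f i. \<rho> x f i = F x (i - sh x) * f (i - sh x)"
  shows "lie_act \<rho> h f i = lie_coeff sh F h (i - lie_shift sh h) * f (i - lie_shift sh h)"
  by (induction h arbitrary: f i) (simp_all add: assms algebra_simps)

lemma lie_coeff_scale_C:
  "lie_coeff sh (\<lambda>x i. if x = LC then \<kappa> * F x i else F x i) h i
     = \<kappa> ^ count_C h * lie_coeff sh F h i"
  by (induction h arbitrary: i) (simp_all add: power_add algebra_simps)

text \<open>Length, number of letters \<open>LC\<close> and this shift together determine the
  multidegree.\<close>

fun degree_shift :: "int \<Rightarrow> letter \<Rightarrow> int" where
  "degree_shift e LA = 1"
| "degree_shift e LB = - 1"
| "degree_shift e LC = e"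

text \<open>This and the next two lemmas compute the gradings with \<open>lnorm\<close> kept folded,
  so that the coefficient tables below still match.\<close>

lemma lie_length_lnorm: "lie_length (lnorm x xs) = Suc (length xs)"
proof -
  have "lie_length (foldl (\<lambda>u y. Br u (Ltr y)) u xs) = lie_length u + length xs" for u
    by (induction xs arbitrary: u) simp_all
  then show ?thesis by (simp add: lnorm_def)
qed

lemma count_C_lnorm: "count_C (lnorm x xs) = count_list (x # xs) LC"
proof -
  have "count_C (foldl (\<lambda>u y. Br u (Ltr y)) u xs) = count_C u + count_list xs LC" for u
    by (induction xs arbitrary: u) simp_all
  then show ?thesis by (simp add: lnorm_def)
qed

lemma lie_shift_lnorm: "lie_shift sh (lnorm x xs) = sh x + (\<Sum>y\<leftarrow>xs. sh y)"
proof -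
  have "lie_shift sh (foldl (\<lambda>u y. Br u (Ltr y)) u xs) = lie_shift sh u + (\<Sum>y\<leftarrow>xs. sh y)" for u
    by (induction xs arbitrary: u) simp_all
  then show ?thesis by (simp add: lnorm_def)
qed

context aw
begin

text \<open>The index \<open>e\<close> is the shift of the limit operator \<open>C\<close>: \<open>K\<^sup>-\<^sup>1\<close>, \<open>A K\<^sup>-\<^sup>1\<close>, \<open>B K\<^sup>-\<^sup>1\<close> for \<open>e = 0, 1, -1\<close>.\<close>

fun monomial_coeff :: "int \<Rightarrow> 'k \<Rightarrow> 'k \<Rightarrow> letter \<Rightarrow> int \<Rightarrow> 'k" where
  "monomial_coeff e m g LA i = 1"
| "monomial_coeff e m g LB i = m * K i + g"
| "monomial_coeff e m g LC i = (if e = - 1 then m * K i + g else 1) / K i"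

abbreviation coeff0 :: "int \<Rightarrow> 'k \<Rightarrow> 'k \<Rightarrow> lie_mon \<Rightarrow> 'k" where
  "coeff0 e m g h \<equiv> lie_coeff (degree_shift e) (monomial_coeff e m g) h 0"

end

context aw_closed
begin

text \<open>The limit relation is applied to the delta function at 0 and read off at
  \<open>j\<close>, which selects the shift \<open>j\<close>. Comparing powers of the free parameter
  \<kappa> then selects the number of letters \<open>LC\<close>.\<close>

lemma graded_relation:
  assumes fin: "finite S" and x: "(\<Sum>h\<in>S. scal (r h) * lie_eval h) \<in> aw_ideal q"
    and len: "\<And>h. h \<in> S \<Longrightarrow> n < lie_length h \<Longrightarrow> r h = 0"
    and e: "e \<in> {- 1, 0, 1}"
  shows "(\<Sum>h\<in>{h\<in>S. lie_length h = n \<and> count_C h = d \<and> lie_shift (degree_shift e) h = j}.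
            r h * coeff0 e m g h) = 0"
proof -
  let ?S = "{h\<in>S. lie_length h = n}"
  let ?sh = "degree_shift e"
  define F where "F \<kappa> x i = (if x = LC then \<kappa> * monomial_coeff e m g x i else monomial_coeff e m g x i)"
    for \<kappa> x i
  define f :: "int \<Rightarrow> 'k" where "f i = (if i = 0 then 1 else 0)" for i
  have limit: "(\<Sum>h\<in>?S. r h * lie_act (tri 0 0 a' 0 b' c m g) h f j) = 0"
    if "poly_function a" "poly_function (\<lambda>s. A' s)" "poly_function b" "poly_function (\<lambda>s. B' s)"
      "\<And>s. a s * A' s = s\<^sup>2" "\<And>s. b s * B' s = s\<^sup>2" "a 0 = 0" "b 0 = 0" "A' 0 = a'" "B' 0 = b'"
    for a A' b B' and a' b' c :: 'k
    using lie_act_limit[OF fin x len that(1-6), where i = j and f = f] that(7-10) by simp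
  have "(\<Sum>h\<in>?S. (if lie_shift ?sh h = j then r h * coeff0 e m g h else 0) * \<kappa> ^ count_C h) = 0"
    if \<kappa>: "\<kappa> \<noteq> 0" for \<kappa>
  proof -
    \<comment> \<open>Exactly one of the three entries of \<open>LC\<close> survives: the one with
      \<open>c\<close>, \<open>b'\<close> or \<open>a'\<close> for \<open>e = 0\<close>,
      \<open>1\<close>, \<open>-1\<close>. Its parameter is chosen so that the entry carries the
      factor \<kappa>.\<close>
    obtain a' b' c where T: "\<And>x f i. tri 0 0 a' 0 b' c m g x f i = F \<kappa> x (i - ?sh x) * f (i - ?sh x)"
      and 0: "(\<Sum>h\<in>?S. r h * lie_act (tri 0 0 a' 0 b' c m g) h f j) = 0"
    proof -
      consider "e = 0" | "e = 1" | "e = - 1" using e by auto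
      then show ?thesis
      proof cases
        case 1
        show ?thesis
        proof (rule that)
          show "tri 0 0 0 0 0 (- q * \<kappa>) m g x f i = F \<kappa> x (i - ?sh x) * f (i - ?sh x)" for x f i
            using q_nonzero by (cases x) (simp_all add: tri_def phi_def F_def 1)
          show "(\<Sum>h\<in>?S. r h * lie_act (tri 0 0 0 0 0 (- q * \<kappa>) m g) h f j) = 0"
            by (rule limit[of "\<lambda>s. s" "\<lambda>s. s" "\<lambda>s. s" "\<lambda>s. s"])
               (simp_all add: poly_function_id power2_eq_square)
        qed
      next
        case 2
        show ?thesis
        proof (rule that)
          show "tri 0 0 0 0 (- q * \<kappa>) 0 m g x f i = F \<kappa> x (i - ?sh x) * f (i - ?sh x)" for x f i
            using q_nonzero by (cases x) (simp_all add: tri_def phi_def F_def 2)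
          show "(\<Sum>h\<in>?S. r h * lie_act (tri 0 0 0 0 (- q * \<kappa>) 0 m g) h f j) = 0"
            \<comment> \<open>Here \<open>b'\<close> is a nonzero constant, so \<open>b\<close> must
              be \<open>s^2 / b'\<close>, which vanishes at \<open>s = 0\<close>.\<close>
            by (rule limit[of "\<lambda>s. s" "\<lambda>s. s" "\<lambda>s. s\<^sup>2 / (- q * \<kappa>)" "\<lambda>s. - q * \<kappa>"])
               (use \<kappa> q_nonzero in \<open>auto intro!: poly_function_intros simp: power2_eq_square\<close>)
        qed
      next
        case 3
        show ?thesis
        proof (rule that)
          show "tri 0 0 (- \<kappa> / q) 0 0 0 m g x f i = F \<kappa> x (i - ?sh x) * f (i - ?sh x)" for x f i
            using q_nonzero by (cases x) (simp_all add: tri_def phi_def F_def 3)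
          show "(\<Sum>h\<in>?S. r h * lie_act (tri 0 0 (- \<kappa> / q) 0 0 0 m g) h f j) = 0"
            by (rule limit[of "\<lambda>s. s\<^sup>2 / (- \<kappa> / q)" "\<lambda>s. - \<kappa> / q" "\<lambda>s. s" "\<lambda>s. s"])
               (use \<kappa> q_nonzero in \<open>auto intro!: poly_function_intros simp: power2_eq_square\<close>)
        qed
      qed
    qed
    have "r h * lie_act (tri 0 0 a' 0 b' c m g) h f j
        = (if lie_shift ?sh h = j then r h * coeff0 e m g h else 0) * \<kappa> ^ count_C h" for h
      unfolding lie_act_monomial[of "tri 0 0 a' 0 b' c m g" "F \<kappa>" ?sh, OF T] F_def[abs_def]
        lie_coeff_scale_C
      by (auto simp: f_def)
    then show ?thesis using 0 by simp
  qed
  then have *: "(\<Sum>h\<in>{h\<in>?S. count_C h = d}. if lie_shift ?sh h = j then r h * coeff0 e m g h else 0) = 0"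
    by (rule power_sum_coeff_zero[rotated]) (use fin in simp_all)
  have "{h\<in>S. lie_length h = n \<and> count_C h = d \<and> lie_shift ?sh h = j}
      = {h\<in>{h\<in>?S. count_C h = d}. lie_shift ?sh h = j}" by auto
  also have "(\<Sum>h\<in>\<dots>. r h * coeff0 e m g h)
      = (\<Sum>h\<in>{h\<in>?S. count_C h = d}. if lie_shift ?sh h = j then r h * coeff0 e m g h else 0)"
    using fin by (intro sum.inter_filter) simp
  also note *
  finally show ?thesis .
qed

lemma graded_relation_list:
  assumes "distinct hs" and "(\<Sum>h\<in>set hs. scal (r h) * lie_eval h) \<in> aw_ideal q"
    and "\<forall>h\<in>set hs. n < lie_length h \<longrightarrow> r h = 0" and "e \<in> {- 1, 0, 1}"
  shows "(\<Sum>h\<leftarrow>filter (\<lambda>h. lie_length h = n \<and> count_C h = d \<and> lie_shift (degree_shift e) h = j) hs.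
            r h * coeff0 e m g h) = 0"
  using graded_relation[OF _ assms(2) _ assms(4), where n = n and d = d and j = j and m = m and g = g] assms(1,3)
  by (simp add: sum.distinct_set_conv_list flip: set_filter)

section \<open>Coefficients of the limits and elimination by multidegree\<close>

lemma K_numeral: "K 1 = q\<^sup>2" "K (- 1) = 1 / q\<^sup>2" "K (numeral n) = q ^ (2 * numeral n)"
  "K (- numeral n) = 1 / q ^ (2 * numeral n)"
proof -
  show "K 1 = q\<^sup>2" "K (- 1) = 1 / q\<^sup>2" using K_plus_1[of 0] K_minus_1[of 0] by (simp_all add: K_0)
  have "2 * numeral n = (numeral (num.Bit0 n) :: int)" "2 * numeral n = (numeral (num.Bit0 n) :: nat)" by simp_all
  then show "K (numeral n) = q ^ (2 * numeral n)" "K (- numeral n) = 1 / q ^ (2 * numeral n)"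
    unfolding K_def by (simp_all add: power_int_minus divide_inverse)
qed

text \<open>Here \<open>A\<close>, \<open>B\<close>, \<open>C\<close> commute pairwise up to powers
  of \<open>q\<close> and \<open>A B C = 1\<close>. Hence \<open>[C,A]\<close> commutes with
  \<open>B\<close> and \<open>[B,A]\<close> with \<open>C\<close>, which explains the zeros.\<close>

lemma coeff0_0_K:
  "coeff0 0 1 0 (lnorm LA []) = 1"
  "coeff0 0 1 0 (lnorm LB []) = 1"
  "coeff0 0 1 0 (lnorm LC []) = 1"
  "coeff0 0 1 0 (lnorm LB [LA]) = q\<^sup>2 - 1"
  "coeff0 0 1 0 (lnorm LC [LA]) = - (q\<^sup>2 - 1) / q\<^sup>2"
  "coeff0 0 1 0 (lnorm LC [LB]) = q\<^sup>2 - 1"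
  "coeff0 0 1 0 (lnorm LB [LA, LA]) = (q\<^sup>2 - 1)\<^sup>2"
  "coeff0 0 1 0 (lnorm LC [LA, LA]) = (q\<^sup>2 - 1)\<^sup>2 / q ^ 4"
  "coeff0 0 1 0 (lnorm LB [LA, LB]) = - (q\<^sup>2 - 1)\<^sup>2 / q\<^sup>2"
  "coeff0 0 1 0 (lnorm LC [LB, LB]) = (q\<^sup>2 - 1)\<^sup>2 / q\<^sup>2"
  "coeff0 0 1 0 (lnorm LC [LA, LC]) = - (q\<^sup>2 - 1)\<^sup>2 / q ^ 4"
  "coeff0 0 1 0 (lnorm LC [LB, LC]) = - (q\<^sup>2 - 1)\<^sup>2"
  "coeff0 0 1 0 (lnorm LB [LA, LA, LA]) = (q\<^sup>2 - 1) ^ 3"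
  "coeff0 0 1 0 (lnorm LC [LA, LA, LA]) = - ((q\<^sup>2 - 1) ^ 3) / q ^ 6"
  "coeff0 0 1 0 (lnorm LB [LA, LA, LB]) = - ((q\<^sup>2 - 1) ^ 3 * (q\<^sup>2 + 1)) / q\<^sup>2"
  "coeff0 0 1 0 (lnorm LB [LA, LB, LB]) = (q\<^sup>2 - 1) ^ 3 / q ^ 6"
  "coeff0 0 1 0 (lnorm LC [LB, LB, LB]) = (q\<^sup>2 - 1) ^ 3 / q ^ 6"
  "coeff0 0 1 0 (lnorm LC [LA, LA, LC]) = (q\<^sup>2 - 1) ^ 3 * (q\<^sup>2 + 1) / q ^ 8"
  "coeff0 0 1 0 (lnorm LC [LB, LB, LC]) = - ((q\<^sup>2 - 1) ^ 3 * (q\<^sup>2 + 1)) / q\<^sup>2"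
  "coeff0 0 1 0 (lnorm LC [LA, LC, LC]) = - ((q\<^sup>2 - 1) ^ 3) / q ^ 6"
  "coeff0 0 1 0 (lnorm LC [LB, LC, LC]) = (q\<^sup>2 - 1) ^ 3"
  "coeff0 0 1 0 (lnorm LC [LA, LA, LB]) = - ((q\<^sup>2 - 1) ^ 3) / q\<^sup>2"
  "coeff0 0 1 0 (lnorm LB [LA, LA, LC]) = (q\<^sup>2 - 1) ^ 3 / q\<^sup>2"
  "coeff0 0 1 0 (Br (lnorm LC [LA]) (lnorm LB [LA])) = (q\<^sup>2 - 1) ^ 3 / q\<^sup>2"
  "coeff0 0 1 0 (lnorm LC [LA, LB, LB]) = 0"
  "coeff0 0 1 0 (lnorm LB [LA, LB, LC]) = (q\<^sup>2 - 1) ^ 3 / q\<^sup>2"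
  "coeff0 0 1 0 (Br (lnorm LC [LB]) (lnorm LB [LA])) = (q\<^sup>2 - 1) ^ 3 / q\<^sup>2"
  "coeff0 0 1 0 (lnorm LC [LA, LB, LC]) = 0"
  "coeff0 0 1 0 (lnorm LB [LA, LC, LC]) = 0"
  "coeff0 0 1 0 (Br (lnorm LC [LB]) (lnorm LC [LA])) = (q\<^sup>2 - 1) ^ 3 / q\<^sup>2"
  using q_nonzero by (simp_all add: lnorm_def K_numeral K_0 field_simps power_numeral_reduce)

text \<open>In this limit \<open>A\<close> and \<open>B\<close> are inverse shifts, so every
  monomial containing \<open>[B,A]\<close> vanishes.\<close>

lemma coeff0_0_1:
  "coeff0 0 0 1 (lnorm LC [LA, LA, LB]) = (q\<^sup>2 - 1) ^ 3 / q ^ 4"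
  "coeff0 0 0 1 (lnorm LB [LA, LA, LC]) = 0"
  "coeff0 0 0 1 (Br (lnorm LC [LA]) (lnorm LB [LA])) = 0"
  "coeff0 0 0 1 (lnorm LC [LA, LB, LB]) = - ((q\<^sup>2 - 1) ^ 3) / q\<^sup>2"
  "coeff0 0 0 1 (lnorm LB [LA, LB, LC]) = 0"
  "coeff0 0 0 1 (Br (lnorm LC [LB]) (lnorm LB [LA])) = 0"
  "coeff0 0 0 1 (lnorm LC [LA, LB]) = - (q\<^sup>2 - 1)\<^sup>2 / q\<^sup>2"
  "coeff0 0 0 1 (lnorm LB [LA, LC]) = 0"
  using q_nonzero by (simp_all add: lnorm_def K_numeral K_0 field_simps power_numeral_reduce)

text \<open>Here \<open>C = B K^-1\<close> is the inverse of the shift \<open>A\<close>, so every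
  monomial containing \<open>[C,A]\<close> vanishes.\<close>

lemma coeff0_minus_1_K:
  "coeff0 (- 1) 1 0 (lnorm LC [LA, LA, LB]) = 0"
  "coeff0 (- 1) 1 0 (lnorm LB [LA, LA, LC]) = - ((q\<^sup>2 - 1) ^ 3) / q\<^sup>2"
  "coeff0 (- 1) 1 0 (Br (lnorm LC [LA]) (lnorm LB [LA])) = 0"
  "coeff0 (- 1) 1 0 (lnorm LC [LA, LB, LC]) = 0"
  "coeff0 (- 1) 1 0 (lnorm LB [LA, LC, LC]) = (q\<^sup>2 - 1) ^ 3 / q ^ 4"
  "coeff0 (- 1) 1 0 (Br (lnorm LC [LB]) (lnorm LC [LA])) = 0"
  "coeff0 (- 1) 1 0 (lnorm LC [LA, LB]) = 0"
  "coeff0 (- 1) 1 0 (lnorm LB [LA, LC]) = - (q\<^sup>2 - 1)\<^sup>2 / q\<^sup>2"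
  using q_nonzero by (simp_all add: lnorm_def K_numeral K_0 field_simps power_numeral_reduce)

text \<open>Here \<open>B C = C B = q^2\<close>, so every monomial containing \<open>[C,B]\<close>
  vanishes.\<close>

lemma coeff0_1_K:
  "coeff0 1 1 0 (lnorm LC [LA, LB, LB]) = - ((q\<^sup>2 - 1) ^ 3)"
  "coeff0 1 1 0 (lnorm LB [LA, LB, LC]) = - ((q\<^sup>2 - 1) ^ 3)"
  "coeff0 1 1 0 (Br (lnorm LC [LB]) (lnorm LB [LA])) = 0"
  "coeff0 1 1 0 (lnorm LC [LA, LB, LC]) = (q\<^sup>2 - 1) ^ 3 / q\<^sup>2"
  "coeff0 1 1 0 (lnorm LB [LA, LC, LC]) = (q\<^sup>2 - 1) ^ 3 / q\<^sup>2"
  "coeff0 1 1 0 (Br (lnorm LC [LB]) (lnorm LC [LA])) = 0"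
  using q_nonzero by (simp_all add: lnorm_def K_numeral K_0 field_simps power_numeral_reduce)

text \<open>Descent on the length: once the coefficients of longer monomials vanish, the limits
  apply to the next length. The nonzero coefficients are, up to sign, products of powers of
  \<open>q\<close>, \<open>q^2 - 1\<close> and \<open>q^2 + 1\<close>.\<close>

lemma hall_upto_4_independent:
  assumes x: "(\<Sum>h\<in>hall_upto 4. scal (r h) * lie_eval h) \<in> aw_ideal q" and h: "h \<in> hall_upto 4"
  shows "r h = 0"
proof -
  note rel = graded_relation_list[OF distinct_hall_list4 x[unfolded hall_upto_4]]
  have nz: "q\<^sup>2 + 1 \<noteq> 0" "q \<noteq> 1" "q \<noteq> - 1"
    using q2_neq_1 q2_neq_minus_1 by (auto simp: add_eq_0_iff2)
  note eval = hall_list4_def lie_length_lnorm count_C_lnorm lie_shift_lnorm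
    coeff0_0_K coeff0_0_1 coeff0_1_K coeff0_minus_1_K nz q2_neq_1 q_nonzero
  have len: "\<forall>h\<in>set hall_list4. 4 < lie_length h \<longrightarrow> r h = 0"
    by (auto simp: hall_list4_def lie_length_lnorm)
  note rel4 = rel[OF len]
  \<comment> \<open>The first nine multidegrees contain a single Hall element each. Deleting
    \<open>lie_coeff.simps\<close> keeps the simplifier on the tables.\<close>
  have z_BAAA: "r (lnorm LB [LA, LA, LA]) = 0"
    using rel4[where e = "0" and m = 1 and g = 0 and d = 0 and j = "2"] by (simp add: eval del: lie_coeff.simps)
  have z_CAAA: "r (lnorm LC [LA, LA, LA]) = 0"
    using rel4[where e = "0" and m = 1 and g = 0 and d = 1 and j = "3"] by (simp add: eval del: lie_coeff.simps)
  have z_BAAB: "r (lnorm LB [LA, LA, LB]) = 0"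
    using rel4[where e = "0" and m = 1 and g = 0 and d = 0 and j = "0"] by (simp add: eval del: lie_coeff.simps)
  have z_BABB: "r (lnorm LB [LA, LB, LB]) = 0"
    using rel4[where e = "0" and m = 1 and g = 0 and d = 0 and j = "-2"] by (simp add: eval del: lie_coeff.simps)
  have z_CBBB: "r (lnorm LC [LB, LB, LB]) = 0"
    using rel4[where e = "0" and m = 1 and g = 0 and d = 1 and j = "-3"] by (simp add: eval del: lie_coeff.simps)
  have z_CAAC: "r (lnorm LC [LA, LA, LC]) = 0"
    using rel4[where e = "0" and m = 1 and g = 0 and d = 2 and j = "2"] by (simp add: eval del: lie_coeff.simps)
  have z_CBBC: "r (lnorm LC [LB, LB, LC]) = 0"
    using rel4[where e = "0" and m = 1 and g = 0 and d = 2 and j = "-2"] by (simp add: eval del: lie_coeff.simps)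
  have z_CACC: "r (lnorm LC [LA, LC, LC]) = 0"
    using rel4[where e = "0" and m = 1 and g = 0 and d = 3 and j = "1"] by (simp add: eval del: lie_coeff.simps)
  have z_CBCC: "r (lnorm LC [LB, LC, LC]) = 0"
    using rel4[where e = "0" and m = 1 and g = 0 and d = 3 and j = "-1"] by (simp add: eval del: lie_coeff.simps)
  \<comment> \<open>Multidegrees (2,1,1) and (1,2,1) have three Hall elements each. The limit where
    \<open>A\<close> and \<open>B\<close> commute isolates the first, another commuting pair gives
    the second, and \<open>A B C = 1\<close> the third.\<close>
  have z_CAAB: "r (lnorm LC [LA, LA, LB]) = 0"
    using rel4[where e = "0" and m = 0 and g = 1 and d = 1 and j = "1"] by (simp add: eval del: lie_coeff.simps)
  have z_BAAC: "r (lnorm LB [LA, LA, LC]) = 0"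
    using rel4[where e = "-1" and m = 1 and g = 0 and d = 1 and j = "0"] by (simp add: eval z_CAAB del: lie_coeff.simps)
  have z_CA_BA: "r (Br (lnorm LC [LA]) (lnorm LB [LA])) = 0"
    using rel4[where e = "0" and m = 1 and g = 0 and d = 1 and j = "1"] by (simp add: eval z_CAAB z_BAAC del: lie_coeff.simps)
  have z_CABB: "r (lnorm LC [LA, LB, LB]) = 0"
    using rel4[where e = "0" and m = 0 and g = 1 and d = 1 and j = "-1"] by (simp add: eval del: lie_coeff.simps)
  have z_BABC: "r (lnorm LB [LA, LB, LC]) = 0"
    using rel4[where e = "1" and m = 1 and g = 0 and d = 1 and j = "0"] by (simp add: eval z_CABB del: lie_coeff.simps)
  have z_CB_BA: "r (Br (lnorm LC [LB]) (lnorm LB [LA])) = 0"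
    using rel4[where e = "0" and m = 1 and g = 0 and d = 1 and j = "-1"] by (simp add: eval z_CABB z_BABC del: lie_coeff.simps)
  \<comment> \<open>In multidegree (1,1,2) the limit with \<open>A B C = 1\<close> comes first: it
    kills the two left-normed monomials.\<close>
  have z_CB_CA: "r (Br (lnorm LC [LB]) (lnorm LC [LA])) = 0"
    using rel4[where e = "0" and m = 1 and g = 0 and d = 2 and j = "0"] by (simp add: eval del: lie_coeff.simps)
  have z_BACC: "r (lnorm LB [LA, LC, LC]) = 0"
    using rel4[where e = "-1" and m = 1 and g = 0 and d = 2 and j = "-2"] by (simp add: eval z_CB_CA del: lie_coeff.simps)
  have z_CABC: "r (lnorm LC [LA, LB, LC]) = 0"
    using rel4[where e = "1" and m = 1 and g = 0 and d = 2 and j = "2"] by (simp add: eval z_CB_CA z_BACC del: lie_coeff.simps)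
  note z4 = z_BAAA z_CAAA z_BAAB z_BABB z_CBBB z_CAAC z_CBBC z_CACC z_CBCC z_CAAB z_BAAC z_CA_BA z_CABB z_BABC z_CB_BA z_CB_CA z_BACC z_CABC
  have len: "\<forall>h\<in>set hall_list4. 3 < lie_length h \<longrightarrow> r h = 0"
    by (auto simp: hall_list4_def lie_length_lnorm z4)
  note rel3 = rel[OF len]
  have z_BAA: "r (lnorm LB [LA, LA]) = 0"
    using rel3[where e = "0" and m = 1 and g = 0 and d = 0 and j = "1"] by (simp add: eval del: lie_coeff.simps)
  have z_CAA: "r (lnorm LC [LA, LA]) = 0"
    using rel3[where e = "0" and m = 1 and g = 0 and d = 1 and j = "2"] by (simp add: eval del: lie_coeff.simps)
  have z_BAB: "r (lnorm LB [LA, LB]) = 0"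
    using rel3[where e = "0" and m = 1 and g = 0 and d = 0 and j = "-1"] by (simp add: eval del: lie_coeff.simps)
  have z_CBB: "r (lnorm LC [LB, LB]) = 0"
    using rel3[where e = "0" and m = 1 and g = 0 and d = 1 and j = "-2"] by (simp add: eval del: lie_coeff.simps)
  have z_CAC: "r (lnorm LC [LA, LC]) = 0"
    using rel3[where e = "0" and m = 1 and g = 0 and d = 2 and j = "1"] by (simp add: eval del: lie_coeff.simps)
  have z_CBC: "r (lnorm LC [LB, LC]) = 0"
    using rel3[where e = "0" and m = 1 and g = 0 and d = 2 and j = "-1"] by (simp add: eval del: lie_coeff.simps)
  \<comment> \<open>In multidegree (1,1,1) both Hall elements vanish when \<open>A B C = 1\<close>,
    so limits with a commuting pair are used.\<close>
  have z_CAB: "r (lnorm LC [LA, LB]) = 0"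
    using rel3[where e = "0" and m = 0 and g = 1 and d = 1 and j = "0"] by (simp add: eval del: lie_coeff.simps)
  have z_BAC: "r (lnorm LB [LA, LC]) = 0"
    using rel3[where e = "-1" and m = 1 and g = 0 and d = 1 and j = "-1"] by (simp add: eval z_CAB del: lie_coeff.simps)
  note z3 = z_BAA z_CAA z_BAB z_CBB z_CAC z_CBC z_CAB z_BAC
  have len: "\<forall>h\<in>set hall_list4. 2 < lie_length h \<longrightarrow> r h = 0"
    by (auto simp: hall_list4_def lie_length_lnorm z3 z4)
  note rel2 = rel[OF len]
  have z_BA: "r (lnorm LB [LA]) = 0"
    using rel2[where e = "0" and m = 1 and g = 0 and d = 0 and j = "0"] by (simp add: eval del: lie_coeff.simps)
  have z_CA: "r (lnorm LC [LA]) = 0"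
    using rel2[where e = "0" and m = 1 and g = 0 and d = 1 and j = "1"] by (simp add: eval del: lie_coeff.simps)
  have z_CB: "r (lnorm LC [LB]) = 0"
    using rel2[where e = "0" and m = 1 and g = 0 and d = 1 and j = "-1"] by (simp add: eval del: lie_coeff.simps)
  note z2 = z_BA z_CA z_CB
  have len: "\<forall>h\<in>set hall_list4. 1 < lie_length h \<longrightarrow> r h = 0"
    by (auto simp: hall_list4_def lie_length_lnorm z2 z3 z4)
  note rel1 = rel[OF len]
  have z_A: "r (lnorm LA []) = 0"
    using rel1[where e = "0" and m = 1 and g = 0 and d = 0 and j = "1"] by (simp add: eval del: lie_coeff.simps)
  have z_B: "r (lnorm LB []) = 0"
    using rel1[where e = "0" and m = 1 and g = 0 and d = 0 and j = "-1"] by (simp add: eval del: lie_coeff.simps)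
  have z_C: "r (lnorm LC []) = 0"
    using rel1[where e = "0" and m = 1 and g = 0 and d = 1 and j = "0"] by (simp add: eval del: lie_coeff.simps)
  note z1 = z_A z_B z_C
  from h show ?thesis
    by (auto simp: hall_upto_4 hall_list4_def z1 z2 z3 z4)
qed

end


section \<open>Linear algebra in the quotient\<close>

lemma ideal_aw_ideal: "ideal (aw_ideal q) ring_of_type_algebra"
  unfolding aw_ideal_def
  by (intro ring.genideal_ideal ring_free_alg) (simp add: ring_of_type_algebra_def)

lemma aw_proj_hom: "aw_proj q \<in> ring_hom ring_of_type_algebra (aw_algebra q)"
  using ideal.rcos_ring_hom[OF ideal_aw_ideal[of q]]
  by (simp add: aw_algebra_def aw_proj_def[abs_def])

lemma aw_proj_closed: "aw_proj q x \<in> carrier (aw_algebra q)"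
  and aw_proj_add: "aw_proj q (x + y) = aw_proj q x \<oplus>\<^bsub>aw_algebra q\<^esub> aw_proj q y"
  and aw_proj_mult: "aw_proj q (x * y) = aw_proj q x \<otimes>\<^bsub>aw_algebra q\<^esub> aw_proj q y"
  and aw_proj_one: "aw_proj q 1 = \<one>\<^bsub>aw_algebra q\<^esub>"
  using ring_hom_memE[OF aw_proj_hom[of q]] by (simp_all add: ring_of_type_algebra_def)

lemma aw_proj_zero: "aw_proj q 0 = \<zero>\<^bsub>aw_algebra q\<^esub>"
  using ring_hom_zero[OF aw_proj_hom ring_free_alg ring_aw_algebra]
  by (simp add: ring_of_type_algebra_def)

lemma aw_proj_eq_zero_iff: "aw_proj q x = \<zero>\<^bsub>aw_algebra q\<^esub> \<longleftrightarrow> x \<in> aw_ideal q"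
proof -
  interpret ideal "aw_ideal q" ring_of_type_algebra by (rule ideal_aw_ideal)
  show ?thesis
    using a_rcos_const[of x] rcos_const_imp_mem[of x]
    by (auto simp: aw_proj_def aw_algebra_def FactRing_def ring_of_type_algebra_def)
qed

lemma aw_proj_diff: "aw_proj q (x - y) = aw_proj q x \<ominus>\<^bsub>aw_algebra q\<^esub> aw_proj q y"
proof -
  interpret ring "aw_algebra q" by (rule ring_aw_algebra)
  have "aw_proj q x = aw_proj q (x - y) \<oplus>\<^bsub>aw_algebra q\<^esub> aw_proj q y"
    by (simp flip: aw_proj_add)
  then show ?thesis
    by (simp add: aw_proj_closed a_minus_def a_assoc r_neg)
qed

lemma std_monomial_Br:
  "std_monomial q (Br u v) = std_monomial q u \<otimes>\<^bsub>aw_algebra q\<^esub> std_monomial q v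
     \<ominus>\<^bsub>aw_algebra q\<^esub> std_monomial q v \<otimes>\<^bsub>aw_algebra q\<^esub> std_monomial q u"
  by (simp add: std_monomial_def comm_def aw_proj_diff aw_proj_mult)

lemma std_monomial_in_lie_subalgebra:
  assumes "lie_subalgebra K V (aw_algebra q)" "range (\<lambda>x. aw_proj q (gen x)) \<subseteq> V"
  shows "std_monomial q h \<in> V"
proof (induction h)
  case (Ltr x)
  then show ?case using assms(2) by (auto simp: std_monomial_def)
next
  case (Br u v)
  then show ?case using assms(1) unfolding std_monomial_Br lie_subalgebra_def by blast
qed

lemma scal_add: "scal (c + d) = scal c + scal d"
  by (simp add: scal_def single_add)

lemma scal_mult: "scal (c * d) = scal c * scal d"
  by (simp add: scal_def mult_single)

lemma scal_one: "scal 1 = 1"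
  by (simp add: scal_def)

lemma scal_zero: "scal 0 = 0"
  by (simp add: scal_def)

text \<open>The image of a field in a nonzero ring is a field; the hypothesis says that the quotient
  is nonzero.\<close>

lemma subfield_aw_scalars:
  fixes q :: "'k::field"
  assumes "1 \<notin> aw_ideal q"
  shows "subfield (aw_scalars q) (aw_algebra q)"
proof -
  let ?K = "ring_of_type_algebra :: 'k ring"
  have "(\<lambda>c. aw_proj q (scal c)) \<in> ring_hom ?K (aw_algebra q)"
    by (rule ring_hom_memI)
       (simp_all add: ring_of_type_algebra_def aw_proj_closed scal_add scal_mult scal_one
          aw_proj_add aw_proj_mult aw_proj_one)
  then interpret ring_hom_ring ?K "aw_algebra q" "\<lambda>c. aw_proj q (scal c)"
    by (intro ring_hom_ringI2 ring_aw_algebra ring_from_type_algebra)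
  have "\<one>\<^bsub>aw_algebra q\<^esub> \<noteq> \<zero>\<^bsub>aw_algebra q\<^esub>"
    using assms aw_proj_eq_zero_iff[of q 1] by (simp add: aw_proj_one)
  then have "subfield ((\<lambda>c. aw_proj q (scal c)) ` carrier ?K) (aw_algebra q)"
    by (intro img_is_subfield field.carrier_is_subfield field_from_type_algebra)
  then show ?thesis by (simp add: aw_scalars_def ring_of_type_algebra_def)
qed

text \<open>\<open>combine\<close> stops at the end of the shorter list, so missing coefficients
  count as 0 and surplus ones are ignored.\<close>

lemma combine_aw_proj:
  "ring.combine (aw_algebra q) (map (\<lambda>c. aw_proj q (scal c)) cs) (map (std_monomial q) us)
     = aw_proj q (\<Sum>i<length us. scal (if i < length cs then cs ! i else 0) * lie_eval (us ! i))"
proof (induction cs arbitrary: us)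
  case Nil
  then show ?case
    by (simp add: ring.combine.simps[OF ring_aw_algebra] scal_zero aw_proj_zero)
next
  case (Cons c cs)
  then show ?case
    by (cases us) (simp_all add: ring.combine.simps[OF ring_aw_algebra] aw_proj_zero
      aw_proj_add aw_proj_mult std_monomial_def sum.lessThan_Suc_shift del: sum.lessThan_Suc cong: if_cong)
qed

lemma independent_std_monomials:
  fixes q :: "'k::field"
  assumes indep: "\<And>r :: lie_mon \<Rightarrow> 'k. (\<Sum>h\<in>set us. scal (r h) * lie_eval h) \<in> aw_ideal q
      \<Longrightarrow> \<forall>h\<in>set us. r h = 0"
    and us: "distinct us" and K: "subfield (aw_scalars q) (aw_algebra q)"
  shows "ring.independent (aw_algebra q) (aw_scalars q) (map (std_monomial q) us)"
proof (rule ring.trivial_combine_imp_independent[OF ring_aw_algebra K])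
  show "set (map (std_monomial q) us) \<subseteq> carrier (aw_algebra q)"
    by (auto simp: std_monomial_def aw_proj_closed)
  fix Ks assume Ks: "set Ks \<subseteq> aw_scalars q"
    and zero: "ring.combine (aw_algebra q) Ks (map (std_monomial q) us) = \<zero>\<^bsub>aw_algebra q\<^esub>"
  have "\<exists>cs. Ks = map (\<lambda>c. aw_proj q (scal c)) cs"
    unfolding ex_map_conv using Ks by (auto simp: aw_scalars_def)
  then obtain cs where cs: "Ks = map (\<lambda>c. aw_proj q (scal c)) cs" by blast
  define c where "c i = (if i < length cs then cs ! i else 0)" for i
  \<comment> \<open>Distinctness of \<open>us\<close> allows coefficients indexed by position to be
    indexed by monomials.\<close>
  define r where "r = c \<circ> inv_into {..<length us} ((!) us)"
  have bij: "bij_betw ((!) us) {..<length us} (set us)"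
    by (rule bij_betw_nth) (simp_all add: us)
  have r: "r (us ! i) = c i" if "i < length us" for i
    using that bij_betw_imp_inj_on[OF bij] by (simp add: r_def)
  have "(\<Sum>h\<in>set us. scal (r h) * lie_eval h) = (\<Sum>i<length us. scal (c i) * lie_eval (us ! i))"
    by (simp add: r flip: sum.reindex_bij_betw[OF bij])
  moreover have "(\<Sum>i<length us. scal (c i) * lie_eval (us ! i)) \<in> aw_ideal q"
    using zero unfolding cs combine_aw_proj aw_proj_eq_zero_iff c_def .
  ultimately have "r (us ! i) = 0" if "i < length us" for i
    using indep that by simp
  then have "cs ! i = 0" if "i < length us" "i < length cs" for i
    using that r[of i] by (simp add: c_def)
  then show "set (take (length (map (std_monomial q) us)) Ks) \<subseteq> {\<zero>\<^bsub>aw_algebra q\<^esub>}"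
    unfolding cs by (auto simp: in_set_conv_nth scal_zero aw_proj_zero)
qed

text \<open>\<open>Span\<close> is the least subspace containing the monomials, and it lies in
  \<open>aw_lie q\<close> because every Lie subalgebra containing the letters contains the
  monomials.\<close>

lemma Span_std_monomials:
  assumes us: "set us = hall_upto n" and K: "subfield (aw_scalars q) (aw_algebra q)"
  shows "ring.Span (aw_algebra q) (aw_scalars q) (map (std_monomial q) us) = aw_lie_upto q n"
proof -
  interpret ring "aw_algebra q" by (rule ring_aw_algebra)
  let ?f = "map (std_monomial q) us"
  have carrier: "set ?f \<subseteq> carrier (aw_algebra q)"
    by (auto simp: std_monomial_def aw_proj_closed)
  have "Span (aw_scalars q) ?f \<subseteq> V"
    if "lie_subalgebra (aw_scalars q) V (aw_algebra q)" "range (\<lambda>x. aw_proj q (gen x)) \<subseteq> V" for V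
    using that std_monomial_in_lie_subalgebra[OF that]
    by (intro subalgebra_Span_incl[OF K]) (auto simp: lie_subalgebra_def)
  then have "Span (aw_scalars q) ?f \<subseteq> aw_lie q"
    unfolding aw_lie_def lie_generated_def by blast
  moreover have "set ?f = std_monomial q ` hall_upto n" by (simp add: us)
  ultimately show ?thesis
    unfolding aw_lie_upto_def linear_span_in_def
    using Span_is_subalgebra[OF K carrier] Span_base_incl[OF K carrier] subalgebra_Span_incl[OF K]
    by (intro equalityI Inter_greatest Inter_lower) auto
qed

theorem theorem6p8:
  fixes q :: "'k::alg_closed_field"
  assumes "q \<noteq> 0" and "q ^ 4 \<noteq> 1"
  shows "card (hall_upto 4) = 32 \<and>
    family_basis (aw_scalars q) (aw_algebra q) (std_monomial q) (hall_upto 4) (aw_lie_upto q 4)"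
proof -
  interpret aw_closed q by unfold_locales (use assms in auto)
  \<comment> \<open>Otherwise the ideal is everything, every combination is a relation, and
    independence fails for coefficients all equal to 1.\<close>
  have "1 \<notin> aw_ideal q"
  proof
    assume "1 \<in> aw_ideal q"
    then have "aw_ideal q = UNIV"
      using ideal.one_imp_carrier[OF ideal_aw_ideal[of q]] by (simp add: ring_of_type_algebra_def)
    then show False
      using hall_upto_4_independent[of "\<lambda>_. 1" "Ltr LA"] by (simp add: hall_upto_def)
  qed
  then have K: "subfield (aw_scalars q) (aw_algebra q)" by (rule subfield_aw_scalars)
  have "ring.independent (aw_algebra q) (aw_scalars q) (map (std_monomial q) us)"
    if "distinct us" "set us = hall_upto 4" for us
    by (rule independent_std_monomials) (use that K hall_upto_4_independent in auto)
  then show ?thesis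
    using card_hall_upto_4 Span_std_monomials[OF _ K]
    by (auto simp: family_basis_def hall_upto_4)
qed

end
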